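(* Let $(u,h)$ be a smooth solution to the problem $$ \left\{ \begin{aligned} &u\cdot\nabla u+\nabla p-h\cdot\nabla h-\Delta u=0 \quad\text{in } \mathbb{R}^2\times\mathbb{T},\\ &u\cdot\nabla h-h\cdot\nabla u-\Delta h=0 \quad\text{in } \mathbb{R}^2\times\mathbb{T},\\ &\nabla\cdot u=\nabla\cdot h=0 \quad\text{in } \mathbb{R}^2\times\mathbb{T},\\ &u(x',z)=u(x',z+2\pi),\quad h(x',z)=h(x',z+2\pi),\\ &\lim_{|x|\to\infty}|u(x)|=0,\quad \lim_{|x|\to\infty}|h(x)|=0, \end{aligned} \right. $$ with finite Dirichlet integral $$\int_{\mathbb{T}}\int_{\mathbb{R}^2}|\nabla u(x)|^2\,dx+\int_{\mathbb{T}}\int_{\mathbb{R}^2}|\nabla h(x)|^2\,dx<\infty .$$ If $u^\theta\equiv 0$ and $h^\theta\equiv0$, then $u\equiv 0$ and $h\equiv 0$.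
   Context: This is the stationary magnetohydrodynamics system: $u(x),h(x)\in\mathbb{R}^3$ are the velocity and magnetic field and $p(x)\in\mathbb{R}$ is the scalar pressure. Here $\mathbb{T}=\mathbb{R}/2\pi\mathbb{Z}$, identified with $[-\pi,\pi]$ with endpoints identified, and points are written $x=(x_1,x_2,x_3)=(x',z)$ with $x'=(x_1,x_2)\in\mathbb{R}^2$, $z=x_3$. In $\mathbb{R}^2\times\mathbb{T}$ the limit $|x|\to\infty$ means $|x'|\to\infty$ (uniformly in $z$). Cylindrical coordinates $(r,\theta,z)$ are given by $r=\sqrt{x_1^2+x_2^2}$, $x_1=r\cos\theta$, $x_2=r\sin\theta$, $z=x_3$, with basis vectors $e_r=(x_1/r,x_2/r,0)$, $e_\theta=(-x_2/r,x_1/r,0)$, $e_z=(0,0,1)$. A vector field $v$ is written $v=v^r e_r+v^\theta e_\theta+v^z e_z$, where the components $v^r,v^\theta,v^z$ are functions of $(r,\theta,z)$ (in general all three variables; no axial symmetry is assumed); in particular $u^\theta$ and $h^\theta$ are the angular (swirl) components of $u$ and $h$. *)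

theory Defs
  imports "HOL-Analysis.Analysis"
begin

section \<open>Differential operators on three-dimensional Euclidean space\<close>

definition partial :: "3 \<Rightarrow> (real^3 \<Rightarrow> 'b::real_normed_vector) \<Rightarrow> real^3 \<Rightarrow> 'b" where
  "partial i f x = frechet_derivative f (at x) (axis i 1)"

text \<open>The derivative of a non-differentiable function is unspecified, so differentiability is
  required explicitly at every order.\<close>

primrec Ck :: "nat \<Rightarrow> (real^3 \<Rightarrow> 'b::real_normed_vector) \<Rightarrow> bool" where
  "Ck 0 f \<longleftrightarrow> continuous_on UNIV f"
| "Ck (Suc k) f \<longleftrightarrow> (\<forall>x. f differentiable (at x)) \<and> (\<forall>i. Ck k (partial i f))"

definition smooth :: "(real^3 \<Rightarrow> 'b::real_normed_vector) \<Rightarrow> bool" where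
  "smooth f \<longleftrightarrow> (\<forall>k. Ck k f)"

definition gradient :: "(real^3 \<Rightarrow> real) \<Rightarrow> real^3 \<Rightarrow> real^3" where
  "gradient p x = (\<chi> i. partial i p x)"

definition divergence :: "(real^3 \<Rightarrow> real^3) \<Rightarrow> real^3 \<Rightarrow> real" where
  "divergence v x = (\<Sum>i\<in>UNIV. partial i v x $ i)"

definition laplacian :: "(real^3 \<Rightarrow> 'b::real_normed_vector) \<Rightarrow> real^3 \<Rightarrow> 'b" where
  "laplacian f x = (\<Sum>i\<in>UNIV. partial i (partial i f) x)"

text \<open>\<open>advect v w\<close> is the vector field \<open>(v \<bullet> \<nabla>) w\<close>.\<close>

definition advect :: "(real^3 \<Rightarrow> real^3) \<Rightarrow> (real^3 \<Rightarrow> 'b::real_normed_vector) \<Rightarrow> real^3 \<Rightarrow> 'b" where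
  "advect v w x = (\<Sum>i\<in>UNIV. v x $ i *\<^sub>R partial i w x)"

definition grad_norm_sq :: "(real^3 \<Rightarrow> real^3) \<Rightarrow> real^3 \<Rightarrow> real" where
  "grad_norm_sq v x = (\<Sum>i\<in>UNIV. \<Sum>j\<in>UNIV. (partial i v x $ j)\<^sup>2)"


section \<open>The slab with periodic vertical direction\<close>

text \<open>A function on the product of the plane with the circle of length \<open>2\<pi>\<close> is represented by a
  function on the whole space that is \<open>2\<pi>\<close>-periodic in the third coordinate. Integrals over the
  product are integrals over one period cell.\<close>

definition z_periodic :: "(real^3 \<Rightarrow> 'b) \<Rightarrow> bool" where
  "z_periodic f \<longleftrightarrow> (\<forall>x. f (x + axis 3 (2 * pi)) = f x)"

definition period_cell :: "(real^3) set" where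
  "period_cell = {x. x $ 3 \<in> {-pi..pi}}"

definition rad :: "real^3 \<Rightarrow> real" where
  "rad x = sqrt ((x $ 1)\<^sup>2 + (x $ 2)\<^sup>2)"

text \<open>The filter of \<open>rad x\<close> tending to infinity, uniformly in the third coordinate.\<close>

definition horizontal_infinity :: "(real^3) filter" where
  "horizontal_infinity = filtercomap rad at_top"


section \<open>Cylindrical components\<close>

definition e_r :: "real^3 \<Rightarrow> real^3" where
  "e_r x = vector [x $ 1 / rad x, x $ 2 / rad x, 0]"

definition e_theta :: "real^3 \<Rightarrow> real^3" where
  "e_theta x = vector [- (x $ 2) / rad x, x $ 1 / rad x, 0]"

definition e_z :: "real^3" where
  "e_z = vector [0, 0, 1]"

text \<open>The coefficients of a field in the orthonormal frame \<open>e_r\<close>, \<open>e_theta\<close>, \<open>e_z\<close>, as functions of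
  the Cartesian point; they are meaningful off the axis \<open>rad x = 0\<close>, where the frame exists.\<close>

definition radial_comp :: "(real^3 \<Rightarrow> real^3) \<Rightarrow> real^3 \<Rightarrow> real" where
  "radial_comp v x = v x \<bullet> e_r x"

definition swirl_comp :: "(real^3 \<Rightarrow> real^3) \<Rightarrow> real^3 \<Rightarrow> real" where
  "swirl_comp v x = v x \<bullet> e_theta x"

definition axial_comp :: "(real^3 \<Rightarrow> real^3) \<Rightarrow> real^3 \<Rightarrow> real" where
  "axial_comp v x = v x \<bullet> e_z"

lemma cylindrical_decomposition:
  assumes "rad x > 0"
  shows "v x = radial_comp v x *\<^sub>R e_r x + swirl_comp v x *\<^sub>R e_theta x + axial_comp v x *\<^sub>R e_z"
proof -
  have r2: "rad x * rad x = x $ 1 * x $ 1 + x $ 2 * x $ 2"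
    by (simp add: rad_def power2_eq_square)
  have key: "a = a * (x $ 1 * x $ 1) / (rad x * rad x) + a * (x $ 2 * x $ 2) / (rad x * rad x)" for a
  proof -
    have "a = a * (rad x * rad x) / (rad x * rad x)"
      using assms by simp
    also have "\<dots> = a * (x $ 1 * x $ 1) / (rad x * rad x) + a * (x $ 2 * x $ 2) / (rad x * rad x)"
      by (simp only: r2 distrib_left add_divide_distrib)
    finally show ?thesis .
  qed
  show ?thesis
    using key[of "v x $ 1"] key[of "v x $ 2"]
    by (simp add: vec_eq_iff forall_3 radial_comp_def swirl_comp_def axial_comp_def e_r_def
        e_theta_def e_z_def inner_vec_def sum_3 algebra_simps)
qed

end

theory Submission
  imports Defs
begin

text \<open>Let \<open>\<phi>\<^sub>R\<close> be a radial cutoff of size \<open>R\<close> in the horizontal variables. Testing the momentum equation with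
\<open>\<phi>\<^sub>R u\<close> and the induction equation with \<open>\<phi>\<^sub>R h\<close>, the quadratic terms combine into divergences, and the
Dirichlet integral localised by \<open>\<phi>\<^sub>R\<close> equals a sum of integrals that contain a derivative of \<open>\<phi>\<^sub>R\<close>
(lemma \<open>energy_identity\<close>): a diffusive term \<open>(\<bar>u\<bar>\<^sup>2 + \<bar>h\<bar>\<^sup>2) \<Delta>\<phi>\<^sub>R\<close>, drift terms that are cubic in the
fields, and the pressure term \<open>p u \<bullet> \<nabla>\<phi>\<^sub>R\<close>. The support of \<open>\<phi>\<^sub>R\<close> has volume of order \<open>R\<^sup>2\<close>, so
the diffusive term tends to zero because the fields decay. The drift terms cannot be bounded like
this, since \<open>\<nabla>\<phi>\<^sub>R\<close> gains only one factor \<open>1 / R\<close>, and about the size of \<open>p\<close> nothing is known.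

Here the absence of swirl helps. Since \<open>\<phi>\<^sub>R\<close> is radial, \<open>u \<bullet> \<nabla>\<phi>\<^sub>R\<close> is a radial function times
\<open>w = x\<^sub>1 u\<^sub>1 + x\<^sub>2 u\<^sub>2\<close>. Without swirl, the horizontal part of \<open>u\<close> is a multiple of the horizontal position,
so the divergence constraint becomes an equation along each horizontal ray: the derivative of \<open>w\<close> along
the ray is a multiple of \<open>\<partial>\<^sub>3 u\<^sub>3\<close>. The right-hand side has vertical mean zero by periodicity, and \<open>w\<close>
vanishes on the axis; hence \<open>w\<close> has vertical mean zero on every vertical line
(\<open>vertical_mean_radial_moment_eq_0\<close>), and it is a weighted average over one period of its own vertical
derivative, \<open>2\<pi> w(x) = \<integral> s \<partial>\<^sub>3w(x + s e\<^sub>3) ds\<close> with \<open>s\<close> between \<open>0\<close> and \<open>2\<pi>\<close>. Thus \<open>w\<close> may be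
replaced by vertical translates of \<open>\<partial>\<^sub>3w\<close>, which the Dirichlet integral controls
(\<open>integral_radial_moment_bound\<close>). For the drift terms this is enough (\<open>drift_bound\<close>). In the pressure term
the vertical derivative is moved from \<open>w\<close> to \<open>p\<close>, and the third component of the momentum equation
expresses \<open>\<partial>\<^sub>3 p\<close> by the fields; its second-order part is integrated by parts once more, so that
only first derivatives of the fields remain and no regularity estimate is involved (\<open>pressure_bound\<close>).

Moving the derivative to \<open>p\<close> requires \<open>p\<close> to be periodic. The equations make \<open>\<nabla>p\<close> periodic, so that \<open>p\<close>
grows over one period by a constant \<open>c\<close>; testing the third component of the momentum equation
with \<open>\<phi>\<^sub>R\<close> gives \<open>\<bar>c\<bar> R\<^sup>2 \<le> C R\<close> for all large \<open>R\<close>, hence \<open>c = 0\<close> (\<open>p_periodic\<close>).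

Let \<open>A R\<close> be \<open>R\<^sup>-\<^sup>2\<close> times the integral of \<open>\<bar>u\<bar>\<^sup>2 + \<bar>h\<bar>\<^sup>2\<close> over the part of the period cell with
horizontal radius at most \<open>R\<close>; it tends to zero by decay. All terms together are
bounded by a constant times \<open>1 / R + \<delta> + A R + A R / \<delta>\<close> for all \<open>\<delta> > 0\<close> and \<open>R \<ge> 1\<close> (\<open>energy_bound\<close>), and
\<open>\<delta> = sqrt (A R) + 1 / R\<close> makes this tend to zero. So the gradients of both fields vanish, the fields are
constant, and by decay they are zero.\<close>

section \<open>Integration over truncated period cells\<close>

abbreviation ez :: "real^3" where "ez \<equiv> axis 3 1"

lemma continuous_rad [continuous_intros]: "continuous_on S rad"
  unfolding rad_def by (intro continuous_intros)

lemma abs_component_le_rad: "\<bar>x $ 1\<bar> \<le> rad x" "\<bar>x $ 2\<bar> \<le> rad x"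
  unfolding rad_def by (rule real_le_rsqrt; simp)+

lemma rad_nonneg: "0 \<le> rad x"
  by (simp add: rad_def)

lemma rad_sq: "(rad x)\<^sup>2 = (x $ 1)\<^sup>2 + (x $ 2)\<^sup>2"
  by (simp add: rad_def)

lemma rad_add_ez [simp]: "rad (x + s *\<^sub>R ez) = rad x"
  by (simp add: rad_def axis_def)

lemma ez_components [simp]: "ez $ 1 = 0" "ez $ 2 = 0" "ez $ 3 = 1"
  by (simp_all add: axis_def)

lemma add_ez_components [simp]:
  "(x + s *\<^sub>R ez) $ 1 = x $ 1" "(x + s *\<^sub>R ez) $ 2 = x $ 2" "(x + s *\<^sub>R ez) $ 3 = x $ 3 + s"
  by (simp_all add: axis_def)

text \<open>The slab is half-open in the vertical direction so that consecutive slabs are disjoint and a vertical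
translation can be cut and reassembled exactly.\<close>

definition slab :: "real \<Rightarrow> real \<Rightarrow> real \<Rightarrow> (real^3) set" where
  "slab a b R = {x. rad x \<le> R \<and> a \<le> x $ 3 \<and> x $ 3 < b}"

definition cell :: "real \<Rightarrow> (real^3) set" where
  "cell R = slab (-pi) pi R"

lemma slab_borel [measurable]: "slab a b R \<in> sets borel"
proof -
  have "slab a b R = {x. rad x \<le> R} \<inter> {x. a \<le> x $ 3} \<inter> {x. x $ 3 < b}"
    by (auto simp: slab_def)
  moreover have "closed {x. rad x \<le> R}" "closed {x::real^3. a \<le> x $ 3}" "open {x::real^3. x $ 3 < b}"
    by (intro closed_Collect_le open_Collect_less continuous_intros)+
  ultimately show ?thesis by auto
qed

lemma slab_subset_cbox: "slab a b R \<subseteq> cbox (vector [-R, -R, a]) (vector [R, R, b])"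
proof
  fix x assume "x \<in> slab a b R"
  then show "x \<in> cbox (vector [-R, -R, a]) (vector [R, R, b])"
    using abs_component_le_rad[of x]
    by (auto simp: slab_def mem_box_cart forall_3)
qed

lemma set_integrable_slab:
  fixes f :: "real^3 \<Rightarrow> real"
  assumes "continuous_on UNIV f"
  shows "set_integrable lborel (slab a b R) f"
proof (rule set_integrable_subset[OF _ _ slab_subset_cbox])
  show "set_integrable lborel (cbox (vector [-R, -R, a]) (vector [R, R, b])) f"
    unfolding set_integrable_def
    using borel_integrable_compact[OF compact_cbox continuous_on_subset[OF assms subset_UNIV]] .
qed simp

lemma integrable_cell:
  fixes f :: "real^3 \<Rightarrow> real"
  assumes "continuous_on UNIV f"
  shows "f integrable_on cell R"
  using set_borel_integral_eq_integral(1)[OF set_integrable_slab[OF assms]] unfolding cell_def .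

lemma integral_slab_eq:
  fixes f :: "real^3 \<Rightarrow> real"
  assumes "continuous_on UNIV f"
  shows "integral (slab a b R) f = (\<integral>x. indicator (slab a b R) x * f x \<partial>lborel)"
  using set_borel_integral_eq_integral(2)[OF set_integrable_slab[OF assms]]
  by (simp add: set_lebesgue_integral_def)

lemma lborel_integral_translate:
  fixes f :: "real^3 \<Rightarrow> real"
  assumes [measurable]: "f \<in> borel_measurable borel"
  shows "(\<integral>x. f (x + v) \<partial>lborel) = (\<integral>x. f x \<partial>lborel)"
proof -
  have "(\<integral>x. f x \<partial>lborel) = (\<integral>x. f x \<partial>distr lborel borel ((+) v))"
    by (simp add: lborel_distr_plus)
  also have "\<dots> = (\<integral>x. f (v + x) \<partial>lborel)"
    by (rule integral_distr) auto
  finally show ?thesis by (simp add: add.commute)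
qed

lemma integral_slab_translate:
  fixes f :: "real^3 \<Rightarrow> real"
  assumes f: "continuous_on UNIV f"
  shows "integral (slab a b R) (\<lambda>x. f (x + s *\<^sub>R ez)) = integral (slab (a + s) (b + s) R) f"
proof -
  have m: "f \<in> borel_measurable borel" using f by (rule borel_measurable_continuous_onI)
  have c: "continuous_on UNIV (\<lambda>x. f (x + s *\<^sub>R ez))"
    by (rule continuous_on_compose2[OF f]) (auto intro!: continuous_intros)
  have "integral (slab a b R) (\<lambda>x. f (x + s *\<^sub>R ez))
     = (\<integral>x. indicator (slab a b R) x * f (x + s *\<^sub>R ez) \<partial>lborel)"
    by (rule integral_slab_eq[OF c])
  also have "\<dots> = (\<integral>x. (indicator (slab (a + s) (b + s) R) (x + s *\<^sub>R ez) * f (x + s *\<^sub>R ez)) \<partial>lborel)"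
    by (intro Bochner_Integration.integral_cong refl) (simp add: indicator_def slab_def)
  also have "\<dots> = (\<integral>x. (indicator (slab (a + s) (b + s) R) x * f x) \<partial>lborel)"
    by (rule lborel_integral_translate) (use m in measurable)
  also have "\<dots> = integral (slab (a + s) (b + s) R) f"
    by (rule integral_slab_eq[OF f, symmetric])
  finally show ?thesis .
qed

lemma integral_slab_split:
  fixes f :: "real^3 \<Rightarrow> real"
  assumes f: "continuous_on UNIV f" and "a \<le> b" "b \<le> c"
  shows "integral (slab a c R) f = integral (slab a b R) f + integral (slab b c R) f"
proof -
  have "slab a c R = slab a b R \<union> slab b c R" "slab a b R \<inter> slab b c R = {}"
    using assms by (auto simp: slab_def)
  then show ?thesis
    using set_integral_Un[of "slab a b R" "slab b c R" lborel f]
      set_integrable_slab[OF f] set_borel_integral_eq_integral(2)[OF set_integrable_slab[OF f]]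
    by metis
qed

lemma z_periodic_2pi: "z_periodic f \<Longrightarrow> f (x + (2 * pi) *\<^sub>R ez) = f x"
proof -
  assume "z_periodic f"
  moreover have "(2 * pi) *\<^sub>R ez = axis 3 (2 * pi)"
    by (simp add: vec_eq_iff axis_def)
  ultimately show ?thesis by (simp add: z_periodic_def)
qed

text \<open>Translating the cell upwards by \<open>s\<close> removes its lowest layer of height \<open>s\<close> and adds a layer above its top;
by periodicity the new layer contributes what the old one did.\<close>

lemma integral_cell_translate:
  fixes f :: "real^3 \<Rightarrow> real"
  assumes f: "continuous_on UNIV f" and per: "z_periodic f" and s: "0 \<le> s" "s \<le> 2 * pi"
  shows "integral (cell R) (\<lambda>x. f (x + s *\<^sub>R ez)) = integral (cell R) f"
proof -
  have "integral (cell R) (\<lambda>x. f (x + s *\<^sub>R ez)) = integral (slab (-pi + s) (pi + s) R) f"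
    unfolding cell_def by (rule integral_slab_translate[OF f])
  also have "\<dots> = integral (slab (-pi + s) pi R) f + integral (slab pi (pi + s) R) f"
    using s by (intro integral_slab_split[OF f]) auto
  also have "integral (slab pi (pi + s) R) f = integral (slab (-pi) (-pi + s) R) (\<lambda>x. f (x + (2 * pi) *\<^sub>R ez))"
    by (subst integral_slab_translate[OF f]) (simp add: algebra_simps)
  also have "\<dots> = integral (slab (-pi) (-pi + s) R) f"
    using z_periodic_2pi[OF per] by simp
  also have "integral (slab (-pi + s) pi R) f + integral (slab (-pi) (-pi + s) R) f = integral (cell R) f"
    unfolding cell_def using s by (subst integral_slab_split[OF f, of "-pi" "-pi + s" pi]) auto
  finally show ?thesis .
qed

lemma integral_slab_swap:
  fixes F :: "real \<Rightarrow> real^3 \<Rightarrow> real"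
  assumes F: "continuous_on UNIV (\<lambda>(t, x). F t x)"
  shows "integral (slab a b R) (\<lambda>x. integral {c..d} (\<lambda>t. F t x))
       = integral {c..d} (\<lambda>t. integral (slab a b R) (F t))"
    and "continuous_on UNIV (\<lambda>x. integral {c..d} (\<lambda>t. F t x))" 
    and "(\<lambda>t. integral (slab a b R) (F t)) integrable_on {c..d}"
proof -
  let ?B = "cbox (vector [-R, -R, a]) (vector [R, R, b]) :: (real^3) set"
  let ?I = "\<lambda>t x. indicator {c..d} t * (indicator (slab a b R) x * F t x) :: real"
  have Fx: "continuous_on UNIV (F t)" for t
  proof -
    have "continuous_on UNIV ((\<lambda>(t, x). F t x) \<circ> (\<lambda>x. (t, x)))"
      by (rule continuous_on_compose[OF _ continuous_on_subset[OF F]]) (auto intro!: continuous_intros)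
    then show ?thesis by (simp add: o_def)
  qed
  have Ft: "continuous_on UNIV (\<lambda>t. F t x)" for x
  proof -
    have "continuous_on UNIV ((\<lambda>(t, x). F t x) \<circ> (\<lambda>t. (t, x)))"
      by (rule continuous_on_compose[OF _ continuous_on_subset[OF F]]) (auto intro!: continuous_intros)
    then show ?thesis by (simp add: o_def)
  qed
  have "set_integrable lborel ({c..d} \<times> slab a b R) (\<lambda>(t, x). F t x)"
  proof (rule set_integrable_subset)
    show "set_integrable lborel ({c..d} \<times> ?B) (\<lambda>(t, x). F t x)"
      unfolding set_integrable_def
      by (intro borel_integrable_compact compact_Times compact_cbox compact_Icc
          continuous_on_subset[OF F] subset_UNIV)
    show "{c..d} \<times> slab a b R \<in> sets lborel"
      by (simp add: borel_Times)
    show "{c..d} \<times> slab a b R \<subseteq> {c..d} \<times> ?B"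
      using slab_subset_cbox by auto
  qed
  then have int: "integrable (lborel \<Otimes>\<^sub>M lborel) (\<lambda>(t, x). ?I t x)"
    unfolding set_integrable_def lborel_prod
    by (rule Bochner_Integration.integrable_cong[THEN iffD1, OF refl, rotated]) (auto simp: indicator_def)
  have tint: "(\<integral>t. ?I t x \<partial>lborel) = indicator (slab a b R) x * integral {c..d} (\<lambda>t. F t x)" for x
  proof -
    have "set_integrable lborel {c..d} (\<lambda>t. F t x)"
      unfolding set_integrable_def
      by (intro borel_integrable_compact compact_Icc continuous_on_subset[OF Ft] subset_UNIV)
    from set_borel_integral_eq_integral(2)[OF this]
    have "integral {c..d} (\<lambda>t. F t x) = (\<integral>t. indicator {c..d} t * F t x \<partial>lborel)"
      by (simp add: set_lebesgue_integral_def)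
    then show ?thesis
      by (simp add: mult.left_commute[of "indicator {c..d} _"])
  qed
  have xint: "(\<integral>x. ?I t x \<partial>lborel) = indicator {c..d} t * integral (slab a b R) (F t)" for t
    by (simp add: integral_slab_eq[OF Fx])
  show c: "continuous_on UNIV (\<lambda>x. integral {c..d} (\<lambda>t. F t x))"
  proof -
    have "continuous_on (UNIV \<times> cbox c d) ((\<lambda>(t, x). F t x) \<circ> prod.swap)"
      by (rule continuous_on_compose[OF _ continuous_on_subset[OF F]])
         (auto intro!: continuous_intros continuous_on_swap)
    then have "continuous_on UNIV (\<lambda>x. integral (cbox c d) (\<lambda>t. F t x))"
      by (intro integral_continuous_on_param) (simp add: o_def split_beta)
    then show ?thesis by simp
  qed
  have i: "integrable lborel (\<lambda>t. indicator {c..d} t * integral (slab a b R) (F t))"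
    using lborel_pair.integrable_fst[OF int] unfolding xint .
  then have si: "set_integrable lborel {c..d} (\<lambda>t. integral (slab a b R) (F t))"
    by (simp add: set_integrable_def)
  from set_borel_integral_eq_integral(1)[OF this]
  show "(\<lambda>t. integral (slab a b R) (F t)) integrable_on {c..d}" .
  show "integral (slab a b R) (\<lambda>x. integral {c..d} (\<lambda>t. F t x))
       = integral {c..d} (\<lambda>t. integral (slab a b R) (F t))"
    using lborel_pair.Fubini_integral[OF int] set_borel_integral_eq_integral(2)[OF si]
    unfolding tint xint integral_slab_eq[OF c]
    by (simp add: set_lebesgue_integral_def)
qed

section \<open>Directional derivatives and integration by parts\<close>

text \<open>Integration by parts along a coordinate axis uses only the one directional derivative and its
continuity, so the predicate records just these; it is then closed under products by one rule for all
bilinear operations, without any Frechet derivative.\<close>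

definition deriv_along :: "3 \<Rightarrow> (real^3 \<Rightarrow> 'b::real_normed_vector) \<Rightarrow> (real^3 \<Rightarrow> 'b) \<Rightarrow> bool" where
  "deriv_along i f f' \<longleftrightarrow> continuous_on UNIV f \<and> continuous_on UNIV f' \<and>
     (\<forall>x. ((\<lambda>t. f (x + t *\<^sub>R axis i 1)) has_vector_derivative f' x) (at 0))"

lemma deriv_along_cont:
  assumes "deriv_along i f f'"
  shows "continuous_on UNIV f" "continuous_on UNIV f'"
  using assms by (simp_all add: deriv_along_def)

lemma deriv_alongD:
  assumes "deriv_along i f f'"
  shows "((\<lambda>t. f (x + t *\<^sub>R axis i 1)) has_vector_derivative f' (x + t *\<^sub>R axis i 1)) (at t)"
proof -
  have "((\<lambda>r. f ((x + t *\<^sub>R axis i 1) + r *\<^sub>R axis i 1)) has_vector_derivative f' (x + t *\<^sub>R axis i 1)) (at 0)"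
    using assms by (auto simp: deriv_along_def)
  moreover have "((\<lambda>r. r - t) has_vector_derivative 1) (at t)"
    by (auto intro!: derivative_eq_intros)
  ultimately have "(((\<lambda>r. f ((x + t *\<^sub>R axis i 1) + r *\<^sub>R axis i 1)) \<circ> (\<lambda>r. r - t)) has_vector_derivative
       1 *\<^sub>R f' (x + t *\<^sub>R axis i 1)) (at t)"
    by (intro vector_diff_chain_at) auto
  then show ?thesis by (simp add: o_def scaleR_left_diff_distrib)
qed

lemma deriv_alongI:
  assumes "continuous_on UNIV f" "continuous_on UNIV f'"
    and "\<And>x. ((\<lambda>t. f (x + t *\<^sub>R axis i 1)) has_vector_derivative f' x) (at 0)"
  shows "deriv_along i f f'"
  using assms by (simp add: deriv_along_def)

lemma deriv_along_at0:
  "deriv_along i f f' \<Longrightarrow> ((\<lambda>t. f (x + t *\<^sub>R axis i 1)) has_vector_derivative f' x) (at 0)"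
  by (simp add: deriv_along_def)

lemma deriv_along_const: "deriv_along i (\<lambda>x. c) (\<lambda>x. 0)"
  by (intro deriv_alongI continuous_on_const has_vector_derivative_const)

lemma deriv_along_add:
  "deriv_along i f f' \<Longrightarrow> deriv_along i g g' \<Longrightarrow> deriv_along i (\<lambda>x. f x + g x) (\<lambda>x. f' x + g' x)"
  by (intro deriv_alongI continuous_on_add has_vector_derivative_add)
     (auto intro: deriv_along_cont deriv_along_at0)

lemma deriv_along_diff:
  "deriv_along i f f' \<Longrightarrow> deriv_along i g g' \<Longrightarrow> deriv_along i (\<lambda>x. f x - g x) (\<lambda>x. f' x - g' x)"
  by (intro deriv_alongI continuous_on_diff has_vector_derivative_diff)
     (auto intro: deriv_along_cont deriv_along_at0)

lemma deriv_along_bilinear: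
  assumes b: "bounded_bilinear b" and f: "deriv_along i f f'" and g: "deriv_along i g g'"
  shows "deriv_along i (\<lambda>x. b (f x) (g x)) (\<lambda>x. b (f x) (g' x) + b (f' x) (g x))"
proof (rule deriv_alongI)
  show "((\<lambda>t. b (f (x + t *\<^sub>R axis i 1)) (g (x + t *\<^sub>R axis i 1))) has_vector_derivative
      b (f x) (g' x) + b (f' x) (g x)) (at 0)" for x
    using bounded_bilinear.has_vector_derivative[OF b deriv_along_at0[OF f, of x] deriv_along_at0[OF g, of x]]
    by simp
qed (intro bounded_bilinear.continuous_on[OF b] continuous_on_add deriv_along_cont[OF f] deriv_along_cont[OF g])+

lemma deriv_along_mult:
  fixes f g :: "real^3 \<Rightarrow> real"
  shows "deriv_along i f f' \<Longrightarrow> deriv_along i g g' \<Longrightarrow>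
    deriv_along i (\<lambda>x. f x * g x) (\<lambda>x. f x * g' x + f' x * g x)"
  by (rule deriv_along_bilinear[OF bounded_bilinear_mult])

lemma deriv_along_inner:
  fixes f g :: "real^3 \<Rightarrow> real^3"
  shows "deriv_along i f f' \<Longrightarrow> deriv_along i g g' \<Longrightarrow>
    deriv_along i (\<lambda>x. f x \<bullet> g x) (\<lambda>x. f x \<bullet> g' x + f' x \<bullet> g x)"
  by (rule deriv_along_bilinear[OF bounded_bilinear_inner])

lemma deriv_along_linear:
  assumes "bounded_linear l" "deriv_along i f f'"
  shows "deriv_along i (\<lambda>x. l (f x)) (\<lambda>x. l (f' x))"
  by (intro deriv_alongI bounded_linear.continuous_on[OF assms(1)] deriv_along_cont[OF assms(2)]
      bounded_linear.has_vector_derivative[OF assms(1)] deriv_along_at0[OF assms(2)])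

lemma deriv_along_component:
  fixes f :: "real^3 \<Rightarrow> real^3"
  shows "deriv_along i f f' \<Longrightarrow> deriv_along i (\<lambda>x. f x $ k) (\<lambda>x. f' x $ k)"
  by (rule deriv_along_linear[OF bounded_linear_vec_nth])

lemma deriv_along_shift:
  assumes "deriv_along i f f'"
  shows "deriv_along i (\<lambda>x. f (x + v)) (\<lambda>x. f' (x + v))"
proof -
  have c: "continuous_on UNIV (\<lambda>x. x + v)" by (intro continuous_intros)
  have "f (x + t *\<^sub>R axis i 1 + v) = f (x + v + t *\<^sub>R axis i 1)" for x t
    by (simp add: algebra_simps)
  then show ?thesis
    using assms
      continuous_on_compose2[OF deriv_along_cont(1)[OF assms] c]
      continuous_on_compose2[OF deriv_along_cont(2)[OF assms] c]
    by (simp add: deriv_along_def)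
qed

lemma deriv_along_coordinate: "deriv_along i (\<lambda>x. x $ k) (\<lambda>x. if i = k then 1 else 0)"
proof -
  have "((\<lambda>t. (x + t *\<^sub>R axis i 1) $ k) has_vector_derivative (if i = k then 1 else 0)) (at 0)" for x :: "real^3"
    by (auto simp: axis_def intro!: derivative_eq_intros)
  then show ?thesis
    by (intro deriv_alongI continuous_intros)
qed

lemma deriv_along_compose:
  assumes "deriv_along i f f'"
    and h: "\<And>y. (h has_real_derivative h' y) (at y)" and h': "continuous_on UNIV h'"
  shows "deriv_along i (\<lambda>x. h (f x)) (\<lambda>x. h' (f x) * f' x)"
proof -
  have ch: "continuous_on UNIV h"
    using h by (meson DERIV_continuous continuous_at_imp_continuous_on)
  have "((\<lambda>t. h (f (x + t *\<^sub>R axis i 1))) has_vector_derivative h' (f x) * f' x) (at 0)" for x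
  proof -
    have "((\<lambda>t. f (x + t *\<^sub>R axis i 1)) has_real_derivative f' x) (at 0)"
      using assms(1) by (auto simp: deriv_along_def has_real_derivative_iff_has_vector_derivative)
    from DERIV_chain2[where f=h, OF _ this, of "h' (f x)"] h
    show ?thesis by (simp add: has_real_derivative_iff_has_vector_derivative)
  qed
  then show ?thesis
    by (intro deriv_alongI continuous_on_mult continuous_on_compose2[OF ch, of UNIV f]
        continuous_on_compose2[OF h', of UNIV f] deriv_along_cont[OF assms(1)] subset_UNIV)
qed

lemma deriv_along_unique:
  assumes "deriv_along i f f'" "deriv_along i f f''"
  shows "f' x = f'' x"
proof (rule vector_derivative_unique_at)
  show "((\<lambda>t. f (x + t *\<^sub>R axis i 1)) has_vector_derivative f' x) (at 0)"
    "((\<lambda>t. f (x + t *\<^sub>R axis i 1)) has_vector_derivative f'' x) (at 0)"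
    using assms by (auto simp: deriv_along_def)
qed

text \<open>Shifting by a period gives another directional derivative of the same function.\<close>

lemma z_periodic_deriv:
  assumes "z_periodic f" "deriv_along i f f'"
  shows "z_periodic f'"
proof -
  have "(\<lambda>x. f (x + axis 3 (2 * pi))) = f"
    using assms(1) by (auto simp: z_periodic_def)
  then have "deriv_along i f (\<lambda>x. f' (x + axis 3 (2 * pi)))"
    using deriv_along_shift[OF assms(2), of "axis 3 (2 * pi)"] by simp
  from deriv_along_unique[OF this assms(2)] show ?thesis
    by (simp add: z_periodic_def)
qed

lemma integral_deriv_along_line:
  fixes f :: "real^3 \<Rightarrow> real"
  assumes d: "deriv_along i f f'" and "a \<le> b"
  shows "integral {a..b} (\<lambda>t. f' (x + t *\<^sub>R axis i 1)) = f (x + b *\<^sub>R axis i 1) - f (x + a *\<^sub>R axis i 1)"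
proof -
  have "((\<lambda>t. f (x + t *\<^sub>R axis i 1)) has_vector_derivative f' (x + t *\<^sub>R axis i 1)) (at t within {a..b})" for t
    by (rule has_vector_derivative_at_within[OF deriv_alongD[OF d]])
  from fundamental_theorem_of_calculus[OF \<open>a \<le> b\<close> this]
  show ?thesis by (rule integral_unique)
qed

lemma deriv_along_vanishes:
  assumes d: "deriv_along i f f'" and van: "\<And>x. R \<le> rad x \<Longrightarrow> f x = 0" and x: "R < rad x"
  shows "f' x = 0"
proof -
  have "open {t::real. R < rad (x + t *\<^sub>R axis i 1)}"
    unfolding rad_def by (intro open_Collect_less continuous_intros)
  from has_vector_derivative_transform_within_open[OF has_vector_derivative_const[of 0 "at 0"] this,
      of "\<lambda>t. f (x + t *\<^sub>R axis i 1)"]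
  have "((\<lambda>t. f (x + t *\<^sub>R axis i 1)) has_vector_derivative 0) (at 0)"
    using x van by simp
  moreover have "((\<lambda>t. f (x + t *\<^sub>R axis i 1)) has_vector_derivative f' x) (at 0)"
    using d by (auto simp: deriv_along_def)
  ultimately show ?thesis
    by (rule vector_derivative_unique_at[symmetric])
qed

lemma rad_triangle: "rad (x + y) \<le> rad x + rad y"
  unfolding rad_def using real_sqrt_sum_squares_triangle_ineq by simp

lemma rad_axis_le: "rad (t *\<^sub>R axis i 1) \<le> \<bar>t\<bar>"
  using exhaust_3[of i] by (auto simp: rad_def axis_def)

lemma integral_cell_translate_horizontal:
  fixes g :: "real^3 \<Rightarrow> real"
  assumes g: "continuous_on UNIV g" and van: "\<And>x. R < rad x \<Longrightarrow> g x = 0"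
    and t: "0 \<le> t" "t \<le> 1" and i: "i \<noteq> 3"
  shows "integral (cell (R + 1)) (\<lambda>x. g (x + t *\<^sub>R axis i 1)) = integral (cell R) g"
proof -
  have m: "g \<in> borel_measurable borel" using g by (rule borel_measurable_continuous_onI)
  have c: "continuous_on UNIV (\<lambda>x. g (x + t *\<^sub>R axis i 1))"
    by (rule continuous_on_compose2[OF g]) (auto intro!: continuous_intros)
  have *: "indicator (slab (-pi) pi (R + 1)) x * g (x + t *\<^sub>R axis i 1)
     = indicator (slab (-pi) pi R) (x + t *\<^sub>R axis i 1) * g (x + t *\<^sub>R axis i 1)" for x
  proof (cases "R < rad (x + t *\<^sub>R axis i 1)")
    case False
    have "x = (x + t *\<^sub>R axis i 1) + (- t) *\<^sub>R axis i 1" by simp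
    then have "rad x \<le> rad (x + t *\<^sub>R axis i 1) + rad ((- t) *\<^sub>R axis i 1)"
      by (metis rad_triangle)
    also have "\<dots> \<le> R + 1"
      using rad_axis_le[of "- t" i] t False by simp
    finally show ?thesis
      using False i by (simp add: indicator_def slab_def axis_def)
  qed (simp add: van)
  have "integral (cell (R + 1)) (\<lambda>x. g (x + t *\<^sub>R axis i 1))
     = (\<integral>x. indicator (slab (-pi) pi (R + 1)) x * g (x + t *\<^sub>R axis i 1) \<partial>lborel)"
    unfolding cell_def by (rule integral_slab_eq[OF c])
  also have "\<dots> = (\<integral>x. (indicator (slab (-pi) pi R) x * g x) \<partial>lborel)"
    unfolding * by (rule lborel_integral_translate) (use m in measurable)
  also have "\<dots> = integral (cell R) g"
    unfolding cell_def by (rule integral_slab_eq[OF g, symmetric])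
  finally show ?thesis .
qed

lemma continuous_line_param:
  fixes f :: "real^3 \<Rightarrow> real"
  assumes "continuous_on UNIV f"
  shows "continuous_on UNIV (\<lambda>(t, x). f (x + t *\<^sub>R v))"
  unfolding split_beta by (rule continuous_on_compose2[OF assms]) (auto intro!: continuous_intros)

text \<open>The integral of the derivative along a segment is a difference of two values. Averaging over the cell
and exchanging the order of integration, both sides are computed by translation invariance: vertically, a
segment of one full period makes the difference vanish pointwise; horizontally, a unit segment and a cell
enlarged by one unit contain every translate of the support, so that the integrals of the two values agree.\<close>

proposition integral_deriv_along_eq_0:
  fixes f :: "real^3 \<Rightarrow> real"
  assumes d: "deriv_along i f f'" and per: "z_periodic f"
    and van: "\<And>x. R \<le> rad x \<Longrightarrow> f x = 0"
  shows "integral (cell R) f' = 0"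
proof (cases "i = 3")
  case True
  note c = deriv_along_cont[OF d]
  have "integral (cell R) (\<lambda>x. integral {0..2*pi} (\<lambda>t. f' (x + t *\<^sub>R ez)))
    = integral {0..2*pi} (\<lambda>t. integral (cell R) (\<lambda>x. f' (x + t *\<^sub>R ez)))"
    unfolding cell_def by (rule integral_slab_swap(1)[OF continuous_line_param[OF c(2)]])
  also have "\<dots> = integral {0..2*pi} (\<lambda>t. integral (cell R) f')"
    by (intro integral_cong integral_cell_translate[OF c(2) z_periodic_deriv[OF per d]]) auto
  also have "\<dots> = 2 * pi * integral (cell R) f'"
    by simp
  also have "integral (cell R) (\<lambda>x. integral {0..2*pi} (\<lambda>t. f' (x + t *\<^sub>R ez))) = 0"
    using integral_deriv_along_line[OF d[unfolded True], of 0 "2*pi"] z_periodic_2pi[OF per] by simp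
  finally show ?thesis by simp
next
  case False
  note c = deriv_along_cont[OF d]
  have "integral (cell (R+1)) (\<lambda>x. integral {0..1} (\<lambda>t. f' (x + t *\<^sub>R axis i 1)))
    = integral {0..1} (\<lambda>t. integral (cell (R+1)) (\<lambda>x. f' (x + t *\<^sub>R axis i 1)))"
    unfolding cell_def by (rule integral_slab_swap(1)[OF continuous_line_param[OF c(2)]])
  also have "\<dots> = integral {0..1::real} (\<lambda>t. integral (cell R) f')"
    by (intro integral_cong integral_cell_translate_horizontal[OF c(2) _ _ _ False])
       (auto intro: deriv_along_vanishes[OF d van])
  also have "\<dots> = integral (cell R) f'"
    by simp
  also have "integral (cell (R+1)) (\<lambda>x. integral {0..1} (\<lambda>t. f' (x + t *\<^sub>R axis i 1)))
     = integral (cell (R+1)) (\<lambda>x. f (x + 1 *\<^sub>R axis i 1) - f (x + 0 *\<^sub>R axis i 1))"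
    using integral_deriv_along_line[OF d, of 0 1] by simp
  also have "\<dots> = integral (cell (R+1)) (\<lambda>x. f (x + 1 *\<^sub>R axis i 1)) - integral (cell (R+1)) (\<lambda>x. f (x + 0 *\<^sub>R axis i 1))"
    by (intro integral_diff integrable_cell)
       (rule continuous_on_compose2[OF c(1)]; auto intro!: continuous_intros)+
  also have "\<dots> = 0"
    using integral_cell_translate_horizontal[OF c(1), of R 1 i] 
      integral_cell_translate_horizontal[OF c(1), of R 0 i] van False by simp
  finally show ?thesis by simp
qed

lemma smooth_Ck: "smooth f \<Longrightarrow> Ck k f"
  by (simp add: smooth_def)

lemma smooth_partial: "smooth f \<Longrightarrow> smooth (partial i f)"
  unfolding smooth_def by (metis Ck.simps(2))

lemma smooth_differentiable: "smooth f \<Longrightarrow> f differentiable (at x)"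
  using smooth_Ck[of f "Suc 0"] by simp

lemma smooth_continuous: "smooth f \<Longrightarrow> continuous_on UNIV f"
  using smooth_Ck[of f 0] by simp

lemma smooth_has_derivative:
  assumes "smooth f"
  shows "(f has_derivative (\<lambda>v. \<Sum>i\<in>UNIV. v $ i *\<^sub>R partial i f x)) (at x)"
proof -
  have D: "(f has_derivative frechet_derivative f (at x)) (at x)"
    using smooth_differentiable[OF assms] by (simp add: frechet_derivative_works)
  then have lin: "linear (frechet_derivative f (at x))"
    by (rule has_derivative_linear)
  have "frechet_derivative f (at x) v = (\<Sum>i\<in>UNIV. v $ i *\<^sub>R partial i f x)" for v
  proof -
    have "v = (\<Sum>i\<in>UNIV. v $ i *\<^sub>R axis i 1)"
      by (simp add: vec_eq_iff forall_3 sum_3 axis_def)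
    then have "frechet_derivative f (at x) v = frechet_derivative f (at x) (\<Sum>i\<in>UNIV. v $ i *\<^sub>R axis i 1)"
      by (rule arg_cong)
    also have "\<dots> = (\<Sum>i\<in>UNIV. v $ i *\<^sub>R partial i f x)"
      by (simp add: linear_sum[OF lin] linear_cmul[OF lin] partial_def)
    finally show ?thesis .
  qed
  then have "frechet_derivative f (at x) = (\<lambda>v. \<Sum>i\<in>UNIV. v $ i *\<^sub>R partial i f x)"
    by (rule ext)
  with D show ?thesis by (rule subst[rotated])
qed

lemma smooth_deriv_along:
  assumes "smooth f"
  shows "deriv_along i f (partial i f)"
proof -
  have "((\<lambda>t. f (x + t *\<^sub>R axis i 1)) has_vector_derivative partial i f x) (at 0)" for x
  proof -
    have D: "(f has_derivative frechet_derivative f (at x)) (at x)"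
      using smooth_differentiable[OF assms] by (simp add: frechet_derivative_works)
    have "((\<lambda>t::real. x + t *\<^sub>R axis i 1) has_derivative (\<lambda>t. t *\<^sub>R axis i 1)) (at 0)"
      by (auto intro!: derivative_eq_intros)
    then have "((\<lambda>t. f (x + t *\<^sub>R axis i 1)) has_derivative (\<lambda>t. frechet_derivative f (at x) (t *\<^sub>R axis i 1))) (at 0)"
      by (rule has_derivative_compose) (use D in simp)
    then show ?thesis
      by (simp add: has_vector_derivative_def partial_def linear_cmul[OF has_derivative_linear[OF D]])
  qed
  then show ?thesis
    using smooth_continuous[OF assms] smooth_continuous[OF smooth_partial[OF assms]]
    by (auto simp: deriv_along_def)
qed

lemma periodic_point_in_strip:
  obtains k :: int where "- pi \<le> (x + (2 * pi * of_int k) *\<^sub>R ez) $ 3" "(x + (2 * pi * of_int k) *\<^sub>R ez) $ 3 < pi"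
proof -
  define t where "t = (x $ 3 + pi) / (2 * pi)"
  have "of_int \<lfloor>t\<rfloor> \<le> t" "t < of_int \<lfloor>t\<rfloor> + 1" by linarith+
  then have "of_int \<lfloor>t\<rfloor> * (2 * pi) \<le> t * (2 * pi)" "t * (2 * pi) < (of_int \<lfloor>t\<rfloor> + 1) * (2 * pi)"
    by (intro mult_right_mono mult_strict_right_mono; simp)+
  moreover have "t * (2 * pi) = x $ 3 + pi" by (simp add: t_def)
  ultimately have "of_int \<lfloor>t\<rfloor> * (2 * pi) \<le> x $ 3 + pi" "x $ 3 + pi < (of_int \<lfloor>t\<rfloor> + 1) * (2 * pi)"
    by simp_all
  then show thesis
    by (intro that[of "- \<lfloor>t\<rfloor>"]) (simp_all add: algebra_simps)
qed

lemma z_periodic_int: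
  assumes "z_periodic f"
  shows "f (x + (2 * pi * of_int k) *\<^sub>R ez) = f x"
proof (induction k rule: int_induct[where k = 0])
  case base
  then show ?case by simp
next
  case (step1 i)
  have "x + (2 * pi * of_int (i + 1)) *\<^sub>R ez = (x + (2 * pi * of_int i) *\<^sub>R ez) + (2 * pi) *\<^sub>R ez"
    by (simp add: vec_eq_iff forall_3 algebra_simps)
  then show ?case using step1(2) z_periodic_2pi[OF assms, of "x + (2 * pi * of_int i) *\<^sub>R ez"] by metis
next
  case (step2 i)
  have "x + (2 * pi * of_int i) *\<^sub>R ez = (x + (2 * pi * of_int (i - 1)) *\<^sub>R ez) + (2 * pi) *\<^sub>R ez"
    by (simp add: vec_eq_iff forall_3 algebra_simps)
  then show ?case using step2(2) z_periodic_2pi[OF assms, of "x + (2 * pi * of_int (i - 1)) *\<^sub>R ez"] by metis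
qed

lemma eq_0_if_gradient_eq_0:
  fixes f :: "real^3 \<Rightarrow> real^3"
  assumes sm: "smooth f" and grad: "\<And>i x. partial i f x = 0"
    and decay: "\<And>e. 0 < e \<Longrightarrow> \<exists>x. norm (f x) \<le> e"
  shows "f x = 0"
proof -
  have "(f has_derivative (\<lambda>h. 0)) (at x)" for x
    using smooth_has_derivative[OF sm, of x] by (simp add: grad)
  then obtain c where c: "\<And>x. f x = c"
    using has_derivative_zero_constant[OF convex_UNIV, of f] by auto
  have "norm c \<le> 0 + e" if "0 < e" for e
    using decay[OF that] by (simp add: c)
  then have "norm c \<le> 0" by (rule field_le_epsilon)
  then show ?thesis using c by simp
qed

section \<open>The radial moment of a swirl-free field\<close>

text \<open>In this polynomial form the condition also makes sense on the axis and can be differentiated.\<close>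

definition swirl_free :: "(real^3 \<Rightarrow> real^3) \<Rightarrow> bool" where
  "swirl_free v \<longleftrightarrow> (\<forall>x. x $ 1 * v x $ 2 = x $ 2 * v x $ 1)"

text \<open>Off the axis this is the radial component times the distance to the axis; unlike the radial component it is
smooth across the axis.\<close>

definition radial_moment :: "(real^3 \<Rightarrow> real^3) \<Rightarrow> real^3 \<Rightarrow> real" where
  "radial_moment v x = x $ 1 * v x $ 1 + x $ 2 * v x $ 2"

lemma swirl_free_if_swirl_comp_0:
  assumes "\<And>x. rad x > 0 \<Longrightarrow> swirl_comp v x = 0"
  shows "swirl_free v"
  unfolding swirl_free_def
proof
  fix x show "x $ 1 * v x $ 2 = x $ 2 * v x $ 1"
  proof (cases "rad x > 0")
    case True
    then have "rad x * swirl_comp v x = 0" using assms by simp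
    moreover have "rad x * swirl_comp v x = x $ 1 * v x $ 2 - x $ 2 * v x $ 1"
      using True by (simp add: swirl_comp_def e_theta_def inner_vec_def sum_3 field_simps)
    ultimately show ?thesis by simp
  next
    case False
    then have "rad x = 0" using rad_nonneg[of x] by simp
    then have "x $ 1 = 0" "x $ 2 = 0" using abs_component_le_rad[of x] by auto
    then show ?thesis by simp
  qed
qed

lemma swirl_free_derivatives:
  assumes sm: "smooth v" and sw: "swirl_free v"
  shows "x $ 1 * partial 1 v x $ 2 + v x $ 2 = x $ 2 * partial 1 v x $ 1"
    and "x $ 1 * partial 2 v x $ 2 = x $ 2 * partial 2 v x $ 1 + v x $ 1"
proof -
  have L: "deriv_along i (\<lambda>x. x $ 1 * v x $ 2)
       (\<lambda>x. x $ 1 * partial i v x $ 2 + (if i = 1 then 1 else 0) * v x $ 2)" for i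
    by (intro deriv_along_mult deriv_along_coordinate deriv_along_component smooth_deriv_along[OF sm])
  have R: "deriv_along i (\<lambda>x. x $ 2 * v x $ 1)
       (\<lambda>x. x $ 2 * partial i v x $ 1 + (if i = 2 then 1 else 0) * v x $ 1)" for i
    by (intro deriv_along_mult deriv_along_coordinate deriv_along_component smooth_deriv_along[OF sm])
  have "(\<lambda>x. x $ 1 * v x $ 2) = (\<lambda>x. x $ 2 * v x $ 1)"
    using sw by (auto simp: swirl_free_def)
  note E = deriv_along_unique[OF L[unfolded this] R]
  show "x $ 1 * partial 1 v x $ 2 + v x $ 2 = x $ 2 * partial 1 v x $ 1"
    using E[of x 1] by simp
  show "x $ 1 * partial 2 v x $ 2 = x $ 2 * partial 2 v x $ 1 + v x $ 1"
    using E[of x 2] by simp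
qed

text \<open>For a field without swirl the horizontal part is \<open>w x'\<close> divided by \<open>\<bar>x'\<bar>\<^sup>2\<close>, where \<open>w\<close> is the radial moment and
\<open>x'\<close> the horizontal position. Multiplying the divergence constraint by \<open>\<bar>x'\<bar>\<^sup>2\<close> therefore leaves a single
derivative, that of \<open>w\<close> in the direction \<open>x'\<close>. The proof below reaches this without the
quotient, from the derivatives of the swirl condition, so it holds at the axis as well.\<close>

lemma radial_moment_ray_derivative:
  assumes sm: "smooth v" and sw: "swirl_free v" and div: "\<And>x. divergence v x = 0"
  shows "((\<lambda>r. radial_moment v (vector [r * a, r * b, c])) has_real_derivative
     - r * (a\<^sup>2 + b\<^sup>2) * partial 3 v (vector [r * a, r * b, c]) $ 3) (at r)"
proof -
  let ?y = "\<lambda>r. vector [r * a, r * b, c] :: real^3"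
  have y: "?y = (\<lambda>r. r *\<^sub>R vector [a, b, 0] + vector [0, 0, c])"
    by (auto simp: vec_eq_iff forall_3)
  have "(?y has_derivative (\<lambda>r. r *\<^sub>R vector [a, b, 0])) (at r)"
    unfolding y by (auto intro!: derivative_eq_intros)
  from has_derivative_compose[OF this smooth_has_derivative[OF sm]]
  have D: "((\<lambda>r. v (?y r)) has_derivative (\<lambda>t. \<Sum>i\<in>UNIV. (t *\<^sub>R vector [a, b, 0]) $ i *\<^sub>R partial i v (?y r))) (at r)" .
  have Dk: "((\<lambda>r. v (?y r) $ k) has_real_derivative a * partial 1 v (?y r) $ k + b * partial 2 v (?y r) $ k) (at r)" for k
    using bounded_linear.has_derivative[OF bounded_linear_vec_nth D, of k]
    unfolding has_field_derivative_def
    by (rule has_derivative_eq_rhs) (auto simp: sum_3 algebra_simps)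
  have "((\<lambda>r. radial_moment v (?y r)) has_real_derivative
      r * a * (a * partial 1 v (?y r) $ 1 + b * partial 2 v (?y r) $ 1) + a * v (?y r) $ 1
    + (r * b * (a * partial 1 v (?y r) $ 2 + b * partial 2 v (?y r) $ 2) + b * v (?y r) $ 2)) (at r)"
    unfolding radial_moment_def vector_3
    by (auto intro!: derivative_eq_intros Dk)
  moreover have "r * a * (a * partial 1 v (?y r) $ 1 + b * partial 2 v (?y r) $ 1) + a * v (?y r) $ 1
    + (r * b * (a * partial 1 v (?y r) $ 2 + b * partial 2 v (?y r) $ 2) + b * v (?y r) $ 2)
    = - r * (a\<^sup>2 + b\<^sup>2) * partial 3 v (?y r) $ 3"
  proof -
    have 1: "r * a * partial 1 v (?y r) $ 2 + v (?y r) $ 2 = r * b * partial 1 v (?y r) $ 1"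
      and 2: "r * a * partial 2 v (?y r) $ 2 = r * b * partial 2 v (?y r) $ 1 + v (?y r) $ 1"
      using swirl_free_derivatives[OF sm sw, of "?y r"] by auto
    have 3: "partial 1 v (?y r) $ 1 + partial 2 v (?y r) $ 2 + partial 3 v (?y r) $ 3 = 0"
      using div[of "?y r"] by (simp add: divergence_def sum_3)
    \<comment> \<open>Substituting the two differentiated swirl conditions turns the left-hand side into \<open>r (a\<^sup>2 + b\<^sup>2) (\<partial>\<^sub>1v\<^sub>1 + \<partial>\<^sub>2v\<^sub>2)\<close>.\<close>
    show ?thesis using 1 2 3 by algebra
  qed
  ultimately show ?thesis by simp
qed

text \<open>The radial moment is zero on the axis, so it is the integral of its derivative along a ray; the
vertical mean of that derivative is the increment of the third component over one period, which is zero.\<close>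

proposition vertical_mean_radial_moment_eq_0:
  assumes sm: "smooth v" and sw: "swirl_free v" and div: "\<And>x. divergence v x = 0" and per: "z_periodic v"
  shows "integral {0..2*pi} (\<lambda>s. radial_moment v (x + s *\<^sub>R ez)) = 0"
proof -
  define a b c where "a = x $ 1" "b = x $ 2" "c = x $ 3"
  define y where "y r s = (vector [r * a, r * b, c + s] :: real^3)" for r s
  define G where "G r s = - r * (a\<^sup>2 + b\<^sup>2) * partial 3 v (y r s) $ 3" for r s
  have y1: "x + s *\<^sub>R ez = y 1 s" for s
    by (simp add: y_def vec_eq_iff forall_3 a_b_c_def axis_def)
  have yz: "y r s = y r 0 + s *\<^sub>R ez" for r s
    by (simp add: y_def vec_eq_iff forall_3 axis_def)
  have ycont: "continuous_on UNIV (\<lambda>(r, s). y r s)"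
  proof -
    have "(\<lambda>(r, s). y r s) = (\<lambda>p. fst p *\<^sub>R vector [a, b, 0] + snd p *\<^sub>R ez + vector [0, 0, c])"
      by (auto simp: y_def vec_eq_iff forall_3 axis_def)
    then show ?thesis by (auto intro!: continuous_intros)
  qed
  have Gcont: "continuous_on UNIV (\<lambda>(r, s). G r s)"
  proof -
    have "continuous_on UNIV (\<lambda>p. partial 3 v ((\<lambda>(r, s). y r s) p))"
      by (rule continuous_on_compose2[OF smooth_continuous[OF smooth_partial[OF sm]] ycont]) auto
    then show ?thesis
      unfolding G_def split_beta by (auto intro!: continuous_intros)
  qed
  have inner: "radial_moment v (y 1 s) = integral {0..1} (\<lambda>r. G r s)" for s
  proof -
    have "((\<lambda>r. radial_moment v (y r s)) has_vector_derivative G r s) (at r within {0..1})" for r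
      using radial_moment_ray_derivative[OF sm sw div, of a b "c + s" r]
      unfolding y_def G_def has_real_derivative_iff_has_vector_derivative
      by (rule has_vector_derivative_at_within)
    from integral_unique[OF fundamental_theorem_of_calculus[OF zero_le_one this]]
    show ?thesis by (simp add: y_def radial_moment_def)
  qed
  have outer: "integral {0..2*pi} (\<lambda>s. G r s) = 0" for r
  proof -
    have "integral {0..2*pi} (\<lambda>t. partial 3 v (y r 0 + t *\<^sub>R ez) $ 3) = 0"
      using integral_deriv_along_line[OF deriv_along_component[OF smooth_deriv_along[OF sm, of 3], where k=3], of 0 "2*pi" "y r 0"]
        z_periodic_2pi[OF per] by simp
    then show ?thesis
      unfolding G_def by (subst yz) simp
  qed
  have "integral {0..2*pi} (\<lambda>s. radial_moment v (x + s *\<^sub>R ez))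
      = integral (cbox 0 (2*pi)) (\<lambda>s. integral (cbox 0 1) (\<lambda>r. G r s))"
    by (simp add: y1 inner)
  also have "\<dots> = integral (cbox 0 1) (\<lambda>r. integral (cbox 0 (2*pi)) (\<lambda>s. G r s))"
    by (rule integral_swap_continuous[symmetric]) (rule continuous_on_subset[OF Gcont subset_UNIV])
  also have "\<dots> = 0"
    using outer by simp
  finally show ?thesis .
qed

lemma deriv_along_radial_moment:
  assumes "smooth v"
  shows "deriv_along i (radial_moment v)
    (\<lambda>x. radial_moment (partial i v) x + (if i = 3 then 0 else v x $ i))"
proof -
  have "deriv_along i (\<lambda>x. x $ 1 * v x $ 1 + x $ 2 * v x $ 2)
     (\<lambda>x. (x $ 1 * partial i v x $ 1 + (if i = 1 then 1 else 0) * v x $ 1)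
        + (x $ 2 * partial i v x $ 2 + (if i = 2 then 1 else 0) * v x $ 2))"
    by (intro deriv_along_add deriv_along_mult deriv_along_coordinate deriv_along_component smooth_deriv_along[OF assms])
  moreover have "radial_moment v = (\<lambda>x. x $ 1 * v x $ 1 + x $ 2 * v x $ 2)"
    by (auto simp: radial_moment_def)
  moreover have "(\<lambda>x. radial_moment (partial i v) x + (if i = 3 then 0 else v x $ i))
    = (\<lambda>x. (x $ 1 * partial i v x $ 1 + (if i = 1 then 1 else 0) * v x $ 1)
        + (x $ 2 * partial i v x $ 2 + (if i = 2 then 1 else 0) * v x $ 2))"
    using exhaust_3[of i] by (auto simp: radial_moment_def)
  ultimately show ?thesis by simp
qed

lemma deriv_along_radial_moment_3:
  "smooth v \<Longrightarrow> deriv_along 3 (radial_moment v) (radial_moment (partial 3 v))"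
  using deriv_along_radial_moment[of v 3] by simp

text \<open>Integrate by parts in \<open>s\<close> against the weight \<open>s\<close>: the boundary term is one full period of the radial moment and
the remaining integral is its vertical mean.\<close>

lemma radial_moment_eq_weighted_derivative:
  assumes sm: "smooth v" and sw: "swirl_free v" and div: "\<And>x. divergence v x = 0" and per: "z_periodic v"
  shows "2 * pi * radial_moment v x = integral {0..2*pi} (\<lambda>s. s * radial_moment (partial 3 v) (x + s *\<^sub>R ez))"
proof -
  note d = deriv_along_radial_moment_3[OF sm]
  have "((\<lambda>s. s * radial_moment v (x + s *\<^sub>R ez)) has_vector_derivative
     s * radial_moment (partial 3 v) (x + s *\<^sub>R ez) + 1 * radial_moment v (x + s *\<^sub>R ez)) (at s within {0..2*pi})" for s
    by (rule has_vector_derivative_at_within[OF has_vector_derivative_mult[OF has_vector_derivative_id deriv_alongD[OF d]]])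
  from fundamental_theorem_of_calculus[OF _ this]
  have 1: "integral {0..2*pi} (\<lambda>s. s * radial_moment (partial 3 v) (x + s *\<^sub>R ez) + radial_moment v (x + s *\<^sub>R ez))
     = 2 * pi * radial_moment v (x + (2 * pi) *\<^sub>R ez)"
    by (intro integral_unique) auto
  have c: "continuous_on UNIV (\<lambda>s. f (x + s *\<^sub>R ez))" if "continuous_on UNIV f" for f :: "real^3 \<Rightarrow> real"
    by (rule continuous_on_compose2[OF that]) (auto intro!: continuous_intros)
  have "integral {0..2*pi} (\<lambda>s. s * radial_moment (partial 3 v) (x + s *\<^sub>R ez) + radial_moment v (x + s *\<^sub>R ez))
     = integral {0..2*pi} (\<lambda>s. s * radial_moment (partial 3 v) (x + s *\<^sub>R ez)) + integral {0..2*pi} (\<lambda>s. radial_moment v (x + s *\<^sub>R ez))"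
    by (intro integral_add integrable_continuous_interval continuous_on_mult continuous_on_id
        continuous_on_subset[OF c[OF deriv_along_cont(1)[OF d]]] continuous_on_subset[OF c[OF deriv_along_cont(2)[OF d]]] subset_UNIV)
  moreover have "radial_moment v (x + (2 * pi) *\<^sub>R ez) = radial_moment v x"
    using z_periodic_2pi[OF per] by (simp add: radial_moment_def)
  ultimately show ?thesis
    using 1 vertical_mean_radial_moment_eq_0[OF assms] by simp
qed

text \<open>This lemma is how the vertical mean zero is used: under an integral, the radial moment may be exchanged for
a translate of its vertical derivative. The factor \<open>\<pi>\<close> is the integral of \<open>s / (2\<pi>)\<close> over one period.\<close>

proposition integral_radial_moment_bound:
  assumes sm: "smooth v" and sw: "swirl_free v" and div: "\<And>x. divergence v x = 0" and per: "z_periodic v"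
    and X: "continuous_on UNIV X"
    and B: "\<And>s. 0 \<le> s \<Longrightarrow> s \<le> 2 * pi \<Longrightarrow>
       \<bar>integral (cell R) (\<lambda>x. X x * radial_moment (partial 3 v) (x + s *\<^sub>R ez))\<bar> \<le> B"
  shows "\<bar>integral (cell R) (\<lambda>x. X x * radial_moment v x)\<bar> \<le> pi * B"
proof -
  note w = deriv_along_cont(2)[OF deriv_along_radial_moment_3[OF sm]]
  let ?F = "\<lambda>s x. X x * (s * radial_moment (partial 3 v) (x + s *\<^sub>R ez))"
  have F: "continuous_on UNIV (\<lambda>(s, x). ?F s x)"
  proof -
    have "continuous_on UNIV (\<lambda>p. X (snd p))" 
      by (rule continuous_on_compose2[OF X]) (auto intro!: continuous_intros)
    then show ?thesis
      using continuous_line_param[OF w, of ez]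
      unfolding split_beta by (intro continuous_on_mult continuous_intros)
  qed
  have Fs: "integral (cell R) (?F s) = s * integral (cell R) (\<lambda>x. X x * radial_moment (partial 3 v) (x + s *\<^sub>R ez))" for s
    by (subst integral_mult_right[symmetric]) (simp add: mult_ac)
  have "2 * pi * integral (cell R) (\<lambda>x. X x * radial_moment v x)
      = integral (cell R) (\<lambda>x. X x * (2 * pi * radial_moment v x))"
    by (subst integral_mult_right[symmetric]) (simp add: mult_ac)
  also have "\<dots> = integral (cell R) (\<lambda>x. integral {0..2*pi} (\<lambda>s. ?F s x))"
    unfolding radial_moment_eq_weighted_derivative[OF sm sw div per] by simp
  also have "\<dots> = integral {0..2*pi} (\<lambda>s. integral (cell R) (?F s))"
    unfolding cell_def by (rule integral_slab_swap(1)[OF F])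
  finally have 1: "2 * pi * integral (cell R) (\<lambda>x. X x * radial_moment v x) = integral {0..2*pi} (\<lambda>s. integral (cell R) (?F s))" .
  have idI: "((\<lambda>s::real. B * s) has_integral B * (2 * pi\<^sup>2)) {0..2*pi}"
    using ident_has_integral[of 0 "2*pi"] by (intro has_integral_mult_right) (simp add: power2_eq_square)
  have "norm (integral {0..2*pi} (\<lambda>s. integral (cell R) (?F s))) \<le> integral {0..2*pi} (\<lambda>s. B * s)"
  proof (rule integral_norm_bound_integral)
    show "(\<lambda>s. integral (cell R) (?F s)) integrable_on {0..2*pi}"
      unfolding cell_def by (rule integral_slab_swap(3)[OF F])
    show "(\<lambda>s. B * s) integrable_on {0..2*pi}"
      using idI by blast
    show "norm (integral (cell R) (?F s)) \<le> B * s" if "s \<in> {0..2*pi}" for s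
      unfolding Fs using mult_right_mono[OF B[of s], of s] that
      by (simp add: abs_mult mult.commute)
  qed
  then have "2 * pi * \<bar>integral (cell R) (\<lambda>x. X x * radial_moment v x)\<bar> \<le> B * (2 * pi\<^sup>2)"
    unfolding 1[symmetric] integral_unique[OF idI] by (simp add: abs_mult)
  then have "(2 * pi) * \<bar>integral (cell R) (\<lambda>x. X x * radial_moment v x)\<bar> \<le> (2 * pi) * (pi * B)"
    by (simp add: power2_eq_square mult_ac)
  then show ?thesis by simp
qed

section \<open>Radial cutoffs and averages over growing cells\<close>

lemma DERIV_max_0_power:
  "((\<lambda>y::real. max 0 y ^ Suc (Suc n)) has_real_derivative real (Suc (Suc n)) * max 0 y ^ Suc n) (at y)"
proof -
  \<comment> \<open>At the kink the difference quotient is itself a positive power of \<open>max 0 t\<close>, which tends to zero.\<close>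
  consider "y > 0" | "y < 0" | "y = 0" by linarith
  then show ?thesis
  proof cases
    case 1
    have "((\<lambda>y. y ^ Suc (Suc n)) has_real_derivative real (Suc (Suc n)) * max 0 y ^ Suc n) (at y)"
      using 1 DERIV_pow[of "Suc (Suc n)" y] by simp
    then show ?thesis
      by (rule has_field_derivative_transform_within_open[where S = "{0<..}"]) (use 1 in auto)
  next
    case 2
    have "((\<lambda>y. 0) has_real_derivative real (Suc (Suc n)) * max 0 y ^ Suc n) (at y)"
      using 2 by simp
    then show ?thesis
      by (rule has_field_derivative_transform_within_open[where S = "{..<0}"]) (use 2 in auto)
  next
    case 3
    have "((\<lambda>t::real. max 0 t ^ Suc n) \<longlongrightarrow> max 0 0 ^ Suc n) (at 0)"
      by (intro tendsto_intros)
    then have "((\<lambda>t::real. max 0 t ^ Suc n) \<longlongrightarrow> 0) (at 0)"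
      by simp
    then have "((\<lambda>t::real. (max 0 t ^ Suc (Suc n) - max 0 0 ^ Suc (Suc n)) / (t - 0)) \<longlongrightarrow> 0) (at 0)"
      by (rule Lim_transform_eventually) (auto simp: eventually_at max_def intro!: exI[of _ 1])
    then show ?thesis
      using 3 by (simp add: has_field_derivative_iff)
  qed
qed

text \<open>The gradient of a radial function is a radial function times this horizontal position vector.\<close>

definition hor :: "3 \<Rightarrow> real^3 \<Rightarrow> real" where
  "hor i x = (if i = 3 then 0 else x $ i)"

text \<open>The third power of this function is twice continuously differentiable, with explicit derivatives.\<close>

definition bump :: "real \<Rightarrow> real^3 \<Rightarrow> real" where
  "bump R x = max 0 (1 - (rad x)\<^sup>2 / R\<^sup>2)"

definition cutoff :: "real \<Rightarrow> real^3 \<Rightarrow> real" where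
  "cutoff R x = bump R x ^ 3"

text \<open>The gradient of the cutoff at \<open>x\<close> is this function times the horizontal position of \<open>x\<close>; the next definition
plays the same role for the gradient of this function.\<close>

definition cutoff_slope :: "real \<Rightarrow> real^3 \<Rightarrow> real" where
  "cutoff_slope R x = - (6 / R\<^sup>2) * bump R x ^ 2"

definition cutoff_curv :: "real \<Rightarrow> real^3 \<Rightarrow> real" where
  "cutoff_curv R x = 24 / R ^ 4 * bump R x"

lemma deriv_along_bump_power:
  "deriv_along i (\<lambda>x. bump R x ^ Suc (Suc n)) (\<lambda>x. real (Suc (Suc n)) * bump R x ^ Suc n * (- (2 / R\<^sup>2) * hor i x))"
proof -
  have r: "(rad x)\<^sup>2 = x $ 1 * x $ 1 + x $ 2 * x $ 2" for x
    by (simp add: rad_sq flip: power2_eq_square)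
  have "deriv_along i (\<lambda>x. 1 - (1 / R\<^sup>2) * (x $ 1 * x $ 1 + x $ 2 * x $ 2))
     (\<lambda>x. 0 - ((1 / R\<^sup>2) * ((x $ 1 * (if i = 1 then 1 else 0) + (if i = 1 then 1 else 0) * x $ 1)
          + (x $ 2 * (if i = 2 then 1 else 0) + (if i = 2 then 1 else 0) * x $ 2)) + 0 * (x $ 1 * x $ 1 + x $ 2 * x $ 2)))"
    by (intro deriv_along_diff deriv_along_mult deriv_along_add deriv_along_const deriv_along_coordinate)
  moreover have "(\<lambda>x. 0 - ((1 / R\<^sup>2) * ((x $ 1 * (if i = 1 then 1 else 0) + (if i = 1 then 1 else 0) * x $ 1)
          + (x $ 2 * (if i = 2 then 1 else 0) + (if i = 2 then 1 else 0) * x $ 2)) + 0 * (x $ 1 * x $ 1 + x $ 2 * x $ 2)))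
      = (\<lambda>x. - (2 / R\<^sup>2) * hor i x)"
    using exhaust_3[of i] by (auto simp: hor_def)
  moreover have "(\<lambda>x. 1 - (1 / R\<^sup>2) * (x $ 1 * x $ 1 + x $ 2 * x $ 2)) = (\<lambda>x. 1 - (rad x)\<^sup>2 / R\<^sup>2)"
    by (simp add: r)
  ultimately have "deriv_along i (\<lambda>x. 1 - (rad x)\<^sup>2 / R\<^sup>2) (\<lambda>x. - (2 / R\<^sup>2) * hor i x)"
    by simp
  moreover have "continuous_on UNIV (\<lambda>y::real. real (Suc (Suc n)) * max 0 y ^ Suc n)"
    by (intro continuous_intros)
  ultimately show ?thesis
    unfolding bump_def by (rule deriv_along_compose[OF _ DERIV_max_0_power[of n]])
qed

lemma deriv_along_cutoff: "deriv_along i (cutoff R) (\<lambda>x. hor i x * cutoff_slope R x)"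
proof -
  have "cutoff R = (\<lambda>x. bump R x ^ Suc (Suc 1))"
    by (auto simp: cutoff_def numeral_3_eq_3)
  moreover have "(\<lambda>x. hor i x * cutoff_slope R x) = (\<lambda>x. real (Suc (Suc 1)) * bump R x ^ Suc 1 * (- (2 / R\<^sup>2) * hor i x))"
    by (auto simp: cutoff_slope_def numeral_2_eq_2)
  ultimately show ?thesis
    using deriv_along_bump_power[of i R 1] by simp
qed

lemma deriv_along_cutoff_slope: "deriv_along i (cutoff_slope R) (\<lambda>x. hor i x * cutoff_curv R x)"
proof -
  have "deriv_along i (\<lambda>x. - (6 / R\<^sup>2) * bump R x ^ Suc (Suc 0))
    (\<lambda>x. - (6 / R\<^sup>2) * (real (Suc (Suc 0)) * bump R x ^ Suc 0 * (- (2 / R\<^sup>2) * hor i x)) + 0 * bump R x ^ Suc (Suc 0))"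
    by (intro deriv_along_mult deriv_along_const deriv_along_bump_power)
  moreover have "(\<lambda>x. - (6 / R\<^sup>2) * (real (Suc (Suc 0)) * bump R x ^ Suc 0 * (- (2 / R\<^sup>2) * hor i x)) + 0 * bump R x ^ Suc (Suc 0))
     = (\<lambda>x. hor i x * cutoff_curv R x)"
    by (auto simp: cutoff_curv_def power2_eq_square power4_eq_xxxx mult_ac)
  ultimately show ?thesis
    by (simp add: cutoff_slope_def[abs_def] numeral_2_eq_2)
qed

lemma deriv_along_hor: "deriv_along j (hor i) (\<lambda>x. if i = j \<and> i \<noteq> 3 then 1 else 0)"
proof (cases "i = 3")
  case True
  then show ?thesis using deriv_along_const[of j 0] by (simp add: hor_def[abs_def])
next
  case False
  then show ?thesis using deriv_along_coordinate[of j i] by (simp add: hor_def[abs_def] eq_commute)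
qed

lemma bump_bounds: "0 \<le> bump R x" "bump R x \<le> 1"
  by (auto simp: bump_def)

lemma bump_eq_0: "0 < R \<Longrightarrow> R \<le> rad x \<Longrightarrow> bump R x = 0"
proof -
  assume "0 < R" "R \<le> rad x"
  then have "R\<^sup>2 \<le> (rad x)\<^sup>2" by (intro power_mono) auto
  then show ?thesis using \<open>0 < R\<close> by (simp add: bump_def)
qed

lemma cutoff_eq_0:
  assumes "0 < R" "R \<le> rad x"
  shows "cutoff R x = 0" "cutoff_slope R x = 0" "cutoff_curv R x = 0"
  unfolding cutoff_def cutoff_slope_def cutoff_curv_def bump_eq_0[OF assms] by auto

lemma cutoff_bounds:
  assumes "0 < R"
  shows "0 \<le> cutoff R x" "cutoff R x \<le> 1" "\<bar>cutoff_slope R x\<bar> \<le> 6 / R\<^sup>2" "\<bar>cutoff_curv R x\<bar> \<le> 24 / R ^ 4"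
proof -
  note b = bump_bounds[of R x]
  show "0 \<le> cutoff R x" "cutoff R x \<le> 1"
    unfolding cutoff_def using b by (simp_all add: power_le_one)
  have "bump R x ^ 2 \<le> 1" using b by (simp add: power_le_one)
  then have "6 / R\<^sup>2 * bump R x ^ 2 \<le> 6 / R\<^sup>2 * 1" by (intro mult_left_mono) auto
  then show "\<bar>cutoff_slope R x\<bar> \<le> 6 / R\<^sup>2" by (simp add: cutoff_slope_def abs_mult)
  have "24 / R ^ 4 * bump R x \<le> 24 / R ^ 4 * 1" using assms b by (intro mult_left_mono) auto
  then show "\<bar>cutoff_curv R x\<bar> \<le> 24 / R ^ 4" using assms b by (simp add: cutoff_curv_def abs_mult)
qed

lemma z_periodic_radial:
  "z_periodic (hor i)" "z_periodic (cutoff R)" "z_periodic (cutoff_slope R)" "z_periodic (cutoff_curv R)"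
proof -
  have e: "axis 3 (2 * pi) = (2 * pi) *\<^sub>R ez"
    by (simp add: vec_eq_iff axis_def)
  have r: "rad (x + axis 3 (2 * pi)) = rad x" for x
    by (simp add: e)
  show "z_periodic (cutoff R)" "z_periodic (cutoff_slope R)" "z_periodic (cutoff_curv R)"
    by (simp_all add: z_periodic_def cutoff_def cutoff_slope_def cutoff_curv_def bump_def r)
  show "z_periodic (hor i)"
    by (simp add: z_periodic_def hor_def axis_def)
qed

lemma cutoff_ge_eighth:
  assumes "0 < R" "(rad x)\<^sup>2 \<le> R\<^sup>2 / 2"
  shows "1 / 8 \<le> cutoff R x"
proof -
  have "(rad x)\<^sup>2 / R\<^sup>2 \<le> 1 / 2"
    using assms by (simp add: field_simps)
  then have "1 / 2 \<le> bump R x" unfolding bump_def by (intro max.coboundedI2) linarith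
  then have "(1 / 2) ^ 3 \<le> bump R x ^ 3" by (intro power_mono) auto
  then show ?thesis by (simp add: cutoff_def power3_eq_cube)
qed

lemma integral_cbox_vector_const:
  fixes a b c d e f :: real
  assumes "a \<le> b" "c \<le> d" "e \<le> f"
  shows "integral (cbox (vector [a, c, e]) (vector [b, d, f]) :: (real^3) set) (\<lambda>x. k::real) = k * ((b - a) * (d - c) * (f - e))"
proof -
  have "cbox (vector [a, c, e]) (vector [b, d, f] :: real^3) \<noteq> {}"
    using assms by (auto simp: interval_ne_empty_cart forall_3)
  from content_cbox_cart[OF this]
  have "measure lborel (cbox (vector [a, c, e]) (vector [b, d, f]) :: (real^3) set) = (b - a) * (d - c) * (f - e)"
    by (simp only: UNIV_3) (simp add: algebra_simps)
  then show ?thesis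
    by (simp only: integral_const real_scaleR_def mult.commute)
qed

lemma volume_cell_le:
  assumes "0 \<le> R"
  shows "integral (cell R) (\<lambda>x. 1::real) \<le> 8 * pi * R\<^sup>2"
proof -
  have "integral (cell R) (\<lambda>x. 1::real) \<le> integral (cbox (vector [-R, -R, -pi]) (vector [R, R, pi]) :: (real^3) set) (\<lambda>x. 1)"
    unfolding cell_def by (intro integral_subset_le slab_subset_cbox integrable_cell[unfolded cell_def]) auto
  also have "\<dots> = 8 * pi * R\<^sup>2"
    using assms by (subst integral_cbox_vector_const) (auto simp: power2_eq_square)
  finally show ?thesis .
qed

lemma integral_cutoff_ge:
  assumes "0 < R"
  shows "pi * R\<^sup>2 / 8 \<le> integral (cell R) (cutoff R)"
proof -
  let ?B = "cbox (vector [-R/2, -R/2, -pi/2]) (vector [R/2, R/2, pi/2]) :: (real^3) set"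
  note c = deriv_along_cont(1)[OF deriv_along_cutoff]
  have rB: "(rad x)\<^sup>2 \<le> R\<^sup>2 / 2" if "x \<in> ?B" for x
  proof -
    have "\<bar>x $ 1\<bar> \<le> R / 2" "\<bar>x $ 2\<bar> \<le> R / 2"
      using that by (auto simp: mem_box_cart forall_3)
    then have "(x $ 1)\<^sup>2 \<le> (R / 2)\<^sup>2" "(x $ 2)\<^sup>2 \<le> (R / 2)\<^sup>2"
      by (auto simp: abs_le_square_iff[symmetric])
    then show ?thesis by (simp add: rad_sq power_divide)
  qed
  have sub: "?B \<subseteq> cell R"
  proof
    fix x assume x: "x \<in> ?B"
    have "(rad x)\<^sup>2 \<le> R\<^sup>2" using rB[OF x] zero_le_power2[of R] by linarith
    from power2_le_imp_le[OF this] assms have "rad x \<le> R" by linarith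
    moreover have "- pi / 2 \<le> x $ 3 \<and> x $ 3 \<le> pi / 2"
      using x unfolding mem_box_cart forall_3 vector_3 by blast
    then have "- pi \<le> x $ 3" "x $ 3 < pi" using pi_gt_zero by linarith+
    ultimately show "x \<in> cell R" unfolding cell_def slab_def by blast
  qed
  have "pi * R\<^sup>2 / 8 = integral ?B (\<lambda>x. 1 / 8)"
    using assms by (subst integral_cbox_vector_const) (auto simp: power2_eq_square)
  also have "\<dots> \<le> integral ?B (cutoff R)"
    using cutoff_ge_eighth[OF assms rB]
    by (intro integral_le integrable_continuous continuous_on_const continuous_on_subset[OF c]) auto
  also have "\<dots> \<le> integral (cell R) (cutoff R)"
    by (intro integral_subset_le sub integrable_continuous continuous_on_subset[OF c] integrable_cell[OF c])
       (auto simp: cutoff_bounds assms)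
  finally show ?thesis .
qed

text \<open>The cell has volume of order \<open>R\<^sup>2\<close>. Beyond a fixed radius the integrand is small, and the part inside this radius
is a constant divided by \<open>R\<^sup>2\<close>.\<close>

lemma mean_square_tendsto_0:
  fixes N :: "real^3 \<Rightarrow> real"
  assumes N: "continuous_on UNIV N" and pos: "\<And>x. 0 \<le> N x"
    and dec: "\<And>e. 0 < e \<Longrightarrow> \<exists>R0. \<forall>x. R0 \<le> rad x \<longrightarrow> N x \<le> e"
  shows "((\<lambda>R. integral (cell R) N / R\<^sup>2) \<longlongrightarrow> 0) at_top"
proof (rule tendstoI)
  fix e :: real assume e: "0 < e"
  define d where "d = e / (16 * pi)"
  have d: "0 < d" using e by (simp add: d_def)
  obtain R0 where R0: "\<And>x. R0 \<le> rad x \<Longrightarrow> N x \<le> d" using dec[OF d] by blast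
  define K where "K = integral (cell R0) N"
  have K: "0 \<le> K" unfolding K_def by (intro integral_nonneg integrable_cell N) (auto simp: pos)
  have "((\<lambda>R. K / R\<^sup>2) \<longlongrightarrow> 0) at_top"
    by (intro tendsto_divide_0[OF tendsto_const] filterlim_at_top_imp_at_infinity filterlim_pow_at_top filterlim_ident) auto
  then have "\<forall>\<^sub>F R in at_top. K / R\<^sup>2 < e / 2"
    using e by (intro order_tendstoD(2)) auto
  moreover have "\<forall>\<^sub>F R in at_top. max 1 R0 \<le> R" by (rule eventually_ge_at_top)
  ultimately show "\<forall>\<^sub>F R in at_top. dist (integral (cell R) N / R\<^sup>2) 0 < e"
  proof eventually_elim
    case (elim R)
    then have R: "1 \<le> R" "R0 \<le> R" by auto
    have sub: "cell R0 \<subseteq> cell R" using R by (auto simp: cell_def slab_def)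
    have Ki: "((\<lambda>x. if x \<in> cell R0 then N x else 0) has_integral K) (cell R)"
      unfolding has_integral_restrict[OF sub] K_def by (intro integrable_integral integrable_cell N)
    have di: "((\<lambda>x. d) has_integral (d * integral (cell R) (\<lambda>x. 1))) (cell R)"
      using has_integral_mult_right[OF integrable_integral[OF integrable_cell[OF continuous_on_const[of UNIV 1]]], of d R]
      by simp
    have "integral (cell R) N \<le> K + d * integral (cell R) (\<lambda>x. 1)"
    proof (rule has_integral_le[OF integrable_integral[OF integrable_cell[OF N]] has_integral_add[OF Ki di]])
      fix x assume x: "x \<in> cell R"
      show "N x \<le> (if x \<in> cell R0 then N x else 0) + d"
        using d R0[of x] x by (auto simp: cell_def slab_def)
    qed
    also have "\<dots> \<le> K + d * (8 * pi * R\<^sup>2)"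
      using d R by (intro add_left_mono mult_left_mono volume_cell_le) auto
    also have "\<dots> = K + e / 2 * R\<^sup>2" by (simp add: d_def)
    finally have "integral (cell R) N / R\<^sup>2 \<le> (K + e / 2 * R\<^sup>2) / R\<^sup>2"
      by (intro divide_right_mono) auto
    also have "\<dots> = K / R\<^sup>2 + e / 2" using R by (simp add: field_simps)
    also have "\<dots> < e" using elim(1) by linarith
    finally have "integral (cell R) N / R\<^sup>2 < e" .
    moreover have "0 \<le> integral (cell R) N"
      by (intro integral_nonneg integrable_cell N) (auto simp: pos)
    ultimately show ?case by simp
  qed
qed

lemma bounded_on_cells:
  fixes N :: "real^3 \<Rightarrow> real"
  assumes N: "continuous_on UNIV N"
    and dec: "\<And>e. 0 < e \<Longrightarrow> \<exists>R0. \<forall>x. R0 \<le> rad x \<longrightarrow> N x \<le> e"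
  obtains B where "1 \<le> B" "\<And>x R. x \<in> cell R \<Longrightarrow> N x \<le> B"
proof -
  obtain R0 where R0: "\<And>x. R0 \<le> rad x \<Longrightarrow> N x \<le> 1" using dec[of 1] by auto
  have "compact (N ` cbox (vector [-R0, -R0, -pi]) (vector [R0, R0, pi]))"
    by (intro compact_continuous_image continuous_on_subset[OF N]) auto
  then obtain M where M: "\<And>x. x \<in> cbox (vector [-R0, -R0, -pi]) (vector [R0, R0, pi]) \<Longrightarrow> \<bar>N x\<bar> \<le> M"
    using compact_imp_bounded bounded_iff by (metis (no_types, lifting) imageI real_norm_def)
  show thesis
  proof (rule that[of "max 1 M"])
    fix x R assume x: "x \<in> cell R"
    show "N x \<le> max 1 M"
    proof (cases "R0 \<le> rad x")
      case False
      then have "x \<in> slab (-pi) pi R0" using x by (auto simp: cell_def slab_def)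
      then have "x \<in> cbox (vector [-R0, -R0, -pi]) (vector [R0, R0, pi])"
        using slab_subset_cbox by blast
      from M[OF this] show ?thesis by auto
    qed (use R0[of x] in auto)
  qed simp
qed

lemma integral_cell_le_nn_integral:
  fixes f :: "real^3 \<Rightarrow> real"
  assumes f: "continuous_on UNIV f" and pos: "\<And>x. 0 \<le> f x"
    and fin: "(\<integral>\<^sup>+x\<in>period_cell. ennreal (f x) \<partial>lborel) < \<infinity>"
  shows "integral (cell R) f \<le> enn2real (\<integral>\<^sup>+x\<in>period_cell. ennreal (f x) \<partial>lborel)"
proof -
  have i: "integrable lborel (\<lambda>x. indicator (slab (-pi) pi R) x * f x)"
    using set_integrable_slab[OF f, of "-pi" pi R] by (simp add: set_integrable_def)
  have "ennreal (integral (cell R) f) = ennreal (\<integral>x. indicator (slab (-pi) pi R) x * f x \<partial>lborel)"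
    unfolding cell_def integral_slab_eq[OF f] ..
  also have "\<dots> = (\<integral>\<^sup>+x. ennreal (indicator (slab (-pi) pi R) x * f x) \<partial>lborel)"
    by (rule nn_integral_eq_integral[OF i, symmetric]) (auto simp: pos)
  also have "\<dots> \<le> (\<integral>\<^sup>+x\<in>period_cell. ennreal (f x) \<partial>lborel)"
    by (intro nn_integral_mono) (auto simp: indicator_def slab_def period_cell_def)
  finally have *: "ennreal (integral (cell R) f) \<le> (\<integral>\<^sup>+x\<in>period_cell. ennreal (f x) \<partial>lborel)" .
  have "enn2real (ennreal (integral (cell R) f)) \<le> enn2real (\<integral>\<^sup>+x\<in>period_cell. ennreal (f x) \<partial>lborel)"
    by (rule enn2real_mono[OF *]) (use fin in auto)
  moreover have "0 \<le> integral (cell R) f"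
    by (intro integral_nonneg integrable_cell f) (auto simp: pos)
  ultimately show ?thesis by simp
qed

lemma hor_simps: "hor 1 x = x $ 1" "hor 2 x = x $ 2" "hor 3 x = 0"
  by (simp_all add: hor_def)

lemma if_eq_3: "(if (1::3) = 3 then a else b) = b" "(if (2::3) = 3 then a else b) = b"
  "(if (3::3) = 3 then a else b) = a"
  by simp_all

text \<open>Each use of the equations below has this form: a pointwise identity up to the divergence of
a periodic field supported in the cell.\<close>

lemma integral_eq_modulo_divergence:
  fixes F F' :: "3 \<Rightarrow> real^3 \<Rightarrow> real"
  assumes d: "\<And>i. deriv_along i (F i) (F' i)" and per: "\<And>i. z_periodic (F i)"
    and van: "\<And>i x. R \<le> rad x \<Longrightarrow> F i x = 0"
    and eq: "\<And>x. X x = (\<Sum>i\<in>UNIV. F' i x) + Y x" and Y: "continuous_on UNIV Y"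
  shows "integral (cell R) X = integral (cell R) Y"
proof -
  have c: "continuous_on UNIV (F' i)" for i using deriv_along_cont(2)[OF d] .
  have "integral (cell R) X = integral (cell R) (\<lambda>x. (\<Sum>i\<in>UNIV. F' i x) + Y x)"
    by (rule integral_cong) (rule eq)
  also have "\<dots> = integral (cell R) (\<lambda>x. \<Sum>i\<in>UNIV. F' i x) + integral (cell R) Y"
    by (intro integral_add integrable_cell Y continuous_on_sum c)
  also have "integral (cell R) (\<lambda>x. \<Sum>i\<in>UNIV. F' i x) = (\<Sum>i\<in>UNIV. integral (cell R) (F' i))"
    by (intro integral_sum integrable_cell c) auto
  also have "\<dots> = 0"
    by (simp add: integral_deriv_along_eq_0[OF d per van])
  finally show ?thesis by simp
qed

lemma abs_integral_cell_le:
  fixes X Y :: "real^3 \<Rightarrow> real"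
  assumes "continuous_on UNIV X" "continuous_on UNIV Y" "\<And>x. x \<in> cell R \<Longrightarrow> \<bar>X x\<bar> \<le> Y x"
  shows "\<bar>integral (cell R) X\<bar> \<le> integral (cell R) Y"
  using integral_norm_bound_integral[OF integrable_cell[OF assms(1)] integrable_cell[OF assms(2)], of R] assms(3)
  by simp

lemma rad_le_cell: "x \<in> cell R \<Longrightarrow> rad x \<le> R"
  by (simp add: cell_def slab_def)

lemma abs_radial_moment_le: "\<bar>radial_moment v x\<bar> \<le> rad x * norm (v x)"
proof (rule abs_le_square_iff[THEN iffD2, THEN order_trans])
  show "\<bar>rad x * norm (v x)\<bar> \<le> rad x * norm (v x)"
    using rad_nonneg[of x] by simp
  have n: "norm (v x) ^ 2 = (v x $ 1)\<^sup>2 + (v x $ 2)\<^sup>2 + (v x $ 3)\<^sup>2"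
    unfolding power2_norm_eq_inner inner_vec_def by (simp add: sum_3 power2_eq_square)
  \<comment> \<open>Cauchy-Schwarz in the plane, by Lagrange's identity.\<close>
  have "(radial_moment v x)\<^sup>2 \<le> ((x $ 1)\<^sup>2 + (x $ 2)\<^sup>2) * ((v x $ 1)\<^sup>2 + (v x $ 2)\<^sup>2)"
  proof -
    have "((x $ 1)\<^sup>2 + (x $ 2)\<^sup>2) * ((v x $ 1)\<^sup>2 + (v x $ 2)\<^sup>2) - (radial_moment v x)\<^sup>2
      = (x $ 1 * v x $ 2 - x $ 2 * v x $ 1)\<^sup>2"
      unfolding radial_moment_def by algebra
    then show ?thesis by (metis diff_ge_0_iff_ge zero_le_power2)
  qed
  also have "\<dots> \<le> ((x $ 1)\<^sup>2 + (x $ 2)\<^sup>2) * norm (v x) ^ 2"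
    unfolding n by (intro mult_left_mono) auto
  finally show "(radial_moment v x)\<^sup>2 \<le> (rad x * norm (v x))\<^sup>2"
    by (simp add: power_mult_distrib rad_sq)
qed

text \<open>The trace of the second derivatives of the cutoff, as computed in the next lemma.\<close>

definition laplacian_cutoff :: "real \<Rightarrow> real^3 \<Rightarrow> real" where
  "laplacian_cutoff R x = 2 * cutoff_slope R x + (rad x)\<^sup>2 * cutoff_curv R x"

lemma deriv_along_grad_cutoff:
  "deriv_along i (\<lambda>x. hor i x * cutoff_slope R x)
     (\<lambda>x. (if i = 3 then 0 else 1) * cutoff_slope R x + (hor i x)\<^sup>2 * cutoff_curv R x)"
proof -
  have "deriv_along i (\<lambda>x. hor i x * cutoff_slope R x)
     (\<lambda>x. hor i x * (hor i x * cutoff_curv R x) + (if i = i \<and> i \<noteq> 3 then 1 else 0) * cutoff_slope R x)"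
    by (intro deriv_along_mult deriv_along_hor deriv_along_cutoff_slope)
  moreover have "(\<lambda>x. hor i x * (hor i x * cutoff_curv R x) + (if i = i \<and> i \<noteq> 3 then 1 else 0) * cutoff_slope R x)
    = (\<lambda>x. (if i = 3 then 0 else 1) * cutoff_slope R x + (hor i x)\<^sup>2 * cutoff_curv R x)"
    by (auto simp: power2_eq_square)
  ultimately show ?thesis by simp
qed

lemma abs_laplacian_cutoff_le:
  assumes "0 < R" "rad x \<le> R"
  shows "\<bar>laplacian_cutoff R x\<bar> \<le> 36 / R\<^sup>2"
proof -
  have "(rad x)\<^sup>2 * \<bar>cutoff_curv R x\<bar> \<le> R\<^sup>2 * (24 / R ^ 4)"
    using assms rad_nonneg[of x] cutoff_bounds(4)[OF assms(1), of x]
    by (intro mult_mono power_mono) auto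
  also have "\<dots> = 24 / R\<^sup>2" using assms by (simp add: power2_eq_square power4_eq_xxxx)
  finally have "(rad x)\<^sup>2 * \<bar>cutoff_curv R x\<bar> \<le> 24 / R\<^sup>2" .
  moreover have "\<bar>laplacian_cutoff R x\<bar> \<le> 2 * \<bar>cutoff_slope R x\<bar> + (rad x)\<^sup>2 * \<bar>cutoff_curv R x\<bar>"
    unfolding laplacian_cutoff_def by (rule order_trans[OF abs_triangle_ineq]) (simp add: abs_mult)
  moreover have "12 / R\<^sup>2 + 24 / R\<^sup>2 = 36 / R\<^sup>2" by (simp add: add_divide_distrib[symmetric])
  ultimately show ?thesis using cutoff_bounds(3)[OF assms(1), of x] by linarith
qed

lemma continuous_cutoffs:
  "continuous_on UNIV (cutoff R)" "continuous_on UNIV (cutoff_slope R)" "continuous_on UNIV (cutoff_curv R)"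
  "continuous_on UNIV (laplacian_cutoff R)" "continuous_on UNIV (hor i)"
proof -
  show "continuous_on UNIV (cutoff R)" by (rule deriv_along_cont(1)[OF deriv_along_cutoff])
  show "continuous_on UNIV (cutoff_slope R)" by (rule deriv_along_cont(1)[OF deriv_along_cutoff_slope])
  show h: "continuous_on UNIV (hor i)" for i by (rule deriv_along_cont(1)[OF deriv_along_hor[of 1]])
  show "continuous_on UNIV (cutoff_curv R)"
    unfolding cutoff_curv_def bump_def divide_inverse by (intro continuous_intros)
  show "continuous_on UNIV (laplacian_cutoff R)"
    unfolding laplacian_cutoff_def cutoff_slope_def cutoff_curv_def bump_def divide_inverse by (intro continuous_intros)
qed

lemma continuous_shift:
  fixes f :: "real^3 \<Rightarrow> 'b::topological_space"
  assumes "continuous_on UNIV f"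
  shows "continuous_on UNIV (\<lambda>x. f (x + v))"
  by (rule continuous_on_compose2[OF assms]) (auto intro!: continuous_intros)

lemma continuous_radial_moment:
  "continuous_on UNIV v \<Longrightarrow> continuous_on UNIV (radial_moment v)"
  unfolding radial_moment_def by (intro continuous_intros)

lemma z_periodic_add: "z_periodic f \<Longrightarrow> z_periodic g \<Longrightarrow> z_periodic (\<lambda>x. f x + g x)"
  and z_periodic_diff: "z_periodic a \<Longrightarrow> z_periodic b \<Longrightarrow> z_periodic (\<lambda>x. a x - b x)"
  and z_periodic_scaleR: "z_periodic r \<Longrightarrow> z_periodic b \<Longrightarrow> z_periodic (\<lambda>x. r x *\<^sub>R b x)"
  and z_periodic_mult: "z_periodic r \<Longrightarrow> z_periodic q \<Longrightarrow> z_periodic (\<lambda>x. r x * q x)"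
  and z_periodic_inner: "z_periodic v \<Longrightarrow> z_periodic w \<Longrightarrow> z_periodic (\<lambda>x. v x \<bullet> w x)"
  and z_periodic_component: "z_periodic v \<Longrightarrow> z_periodic (\<lambda>x. v x $ i)"
  and z_periodic_const: "z_periodic (\<lambda>x. c)"
  for f g :: "real^3 \<Rightarrow> 'f::plus" and a b :: "real^3 \<Rightarrow> 'g::real_normed_vector" and r q :: "real^3 \<Rightarrow> real"
    and v w :: "real^3 \<Rightarrow> real^3"
  by (simp_all add: z_periodic_def)

lemma z_periodic_sum:
  fixes f :: "'i \<Rightarrow> real^3 \<Rightarrow> 'f::comm_monoid_add"
  shows "(\<And>i. z_periodic (f i)) \<Longrightarrow> z_periodic (\<lambda>x. \<Sum>i\<in>A. f i x)"
  by (simp add: z_periodic_def)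

lemma z_periodic_shift: "z_periodic f \<Longrightarrow> z_periodic (\<lambda>x. f (x + v))"
  unfolding z_periodic_def
proof
  fix x assume "\<forall>x. f (x + axis 3 (2 * pi)) = f x"
  from this[rule_format, of "x + v"] show "f (x + axis 3 (2 * pi) + v) = f (x + v)"
    by (simp add: ac_simps)
qed

lemma z_periodic_radial_moment: "z_periodic v \<Longrightarrow> z_periodic (radial_moment v)"
  by (simp add: z_periodic_def radial_moment_def axis_def)

lemma z_periodic_partial: "smooth f \<Longrightarrow> z_periodic f \<Longrightarrow> z_periodic (partial i f)"
  using z_periodic_deriv smooth_deriv_along by blast

lemmas z_periodic_intros = z_periodic_add z_periodic_diff z_periodic_scaleR z_periodic_mult z_periodic_inner
  z_periodic_component z_periodic_const z_periodic_sum

lemma weighted_amgm: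
  fixes a b d :: real
  assumes "0 < d"
  shows "a * b \<le> (d * a\<^sup>2 + b\<^sup>2 / d) / 2"
proof -
  have "0 \<le> (d * a - b)\<^sup>2 / d" using assms by simp
  also have "\<dots> = d * a\<^sup>2 + b\<^sup>2 / d - 2 * (a * b)"
    using assms by (simp add: power2_eq_square field_simps)
  finally show ?thesis by simp
qed

section \<open>The stationary system and its energy density\<close>

text \<open>The hypotheses in the form in which the estimates use them: the number \<open>D\<close> bounds the Dirichlet integral on every
truncated cell, and both decay conditions are merged into one.\<close>

locale swirl_free_mhd =
  fixes u h :: "real^3 \<Rightarrow> real^3" and p :: "real^3 \<Rightarrow> real" and D :: real
  assumes smooth_u: "smooth u" and smooth_h: "smooth h" and smooth_p: "smooth p"
    and momentum: "\<And>x. advect u u x + gradient p x - advect h h x - laplacian u x = 0"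
    and induction_eq: "\<And>x. advect u h x - advect h u x - laplacian h x = 0"
    and div_u: "\<And>x. divergence u x = 0" and div_h: "\<And>x. divergence h x = 0"
    and per_u: "z_periodic u" and per_h: "z_periodic h"
    and swirl_u: "swirl_free u" and swirl_h: "swirl_free h"
    and decay: "\<And>e. 0 < e \<Longrightarrow> \<exists>R0. \<forall>x. R0 \<le> rad x \<longrightarrow> u x \<bullet> u x + h x \<bullet> h x \<le> e"
    and dirichlet: "\<And>R. integral (cell R) (\<lambda>x. \<Sum>i\<in>UNIV. partial i u x \<bullet> partial i u x + partial i h x \<bullet> partial i h x) \<le> D"
begin

definition field_sq :: "real^3 \<Rightarrow> real" where "field_sq x = u x \<bullet> u x + h x \<bullet> h x"

definition grad_sq :: "real^3 \<Rightarrow> real" where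
  "grad_sq x = (\<Sum>i\<in>UNIV. partial i u x \<bullet> partial i u x + partial i h x \<bullet> partial i h x)"

lemmas du = smooth_deriv_along[OF smooth_u] and dh = smooth_deriv_along[OF smooth_h]
  and dp = smooth_deriv_along[OF smooth_p]
  and ddu = smooth_deriv_along[OF smooth_partial[OF smooth_u]]
  and ddh = smooth_deriv_along[OF smooth_partial[OF smooth_h]]

lemmas cont = smooth_continuous[OF smooth_u] smooth_continuous[OF smooth_h] smooth_continuous[OF smooth_p]
  smooth_continuous[OF smooth_partial[OF smooth_u]] smooth_continuous[OF smooth_partial[OF smooth_h]]
  smooth_continuous[OF smooth_partial[OF smooth_p]] 
  smooth_continuous[OF smooth_partial[OF smooth_partial[OF smooth_u]]]
  smooth_continuous[OF smooth_partial[OF smooth_partial[OF smooth_h]]]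
  continuous_radial_moment[OF smooth_continuous[OF smooth_u]]
  continuous_radial_moment[OF smooth_continuous[OF smooth_h]]

lemmas per = per_u per_h z_periodic_partial[OF smooth_u per_u] z_periodic_partial[OF smooth_h per_h]
  z_periodic_partial[OF smooth_partial[OF smooth_u] z_periodic_partial[OF smooth_u per_u]]
  z_periodic_partial[OF smooth_partial[OF smooth_h] z_periodic_partial[OF smooth_h per_h]]

lemma field_sq_cont: "continuous_on UNIV field_sq" and grad_sq_cont: "continuous_on UNIV grad_sq"
  unfolding field_sq_def grad_sq_def by (intro continuous_intros cont)+

lemma field_sq_nonneg: "0 \<le> field_sq x" and grad_sq_nonneg: "0 \<le> grad_sq x"
  unfolding field_sq_def grad_sq_def by (auto intro!: add_nonneg_nonneg sum_nonneg)

lemma field_sq_per: "z_periodic field_sq" and grad_sq_per: "z_periodic grad_sq"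
  unfolding field_sq_def grad_sq_def by (intro z_periodic_intros per)+

lemma norm_u_sq_le: "(norm (u x))\<^sup>2 \<le> field_sq x" and norm_h_sq_le: "(norm (h x))\<^sup>2 \<le> field_sq x"
  by (simp_all add: field_sq_def power2_norm_eq_inner)

lemma gradient_p_eq: "gradient p x = laplacian u x + advect h h x - advect u u x"
  using momentum[of x] by (simp add: algebra_simps)

lemma per_gradient_p: "z_periodic (partial i p)"
proof -
  have "z_periodic (\<lambda>x. (laplacian u x + advect h h x - advect u u x) $ i)"
    unfolding laplacian_def advect_def by (intro z_periodic_intros per)
  moreover have "partial i p = (\<lambda>x. (laplacian u x + advect h h x - advect u u x) $ i)"
    unfolding gradient_p_eq[symmetric] by (simp add: gradient_def)
  ultimately show ?thesis by simp
qed

text \<open>The vertical derivative of the pressure is the only one that has to be expressed by the fields.\<close>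

lemma partial_3_p_eq:
  "partial 3 p x = (\<Sum>i\<in>UNIV. partial i (partial i u) x $ 3 - u x $ i * partial i u x $ 3 + h x $ i * partial i h x $ 3)"
proof -
  have "partial 3 p x = gradient p x $ 3" by (simp add: gradient_def)
  then show ?thesis
    unfolding gradient_p_eq laplacian_def advect_def by (simp add: sum_3)
qed

section \<open>Periodicity of the pressure and the energy identity\<close>

lemma div_3: "partial 1 u x $ 1 + partial 2 u x $ 2 + partial 3 u x $ 3 = 0"
  "partial 1 h x $ 1 + partial 2 h x $ 2 + partial 3 h x $ 3 = 0"
  using div_u[of x] div_h[of x] by (simp_all add: divergence_def sum_3)

lemma field_sq_decay: "0 < e \<Longrightarrow> \<exists>R0. \<forall>x. R0 \<le> rad x \<longrightarrow> field_sq x \<le> e"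
  using decay unfolding field_sq_def .

text \<open>Since both fields are free of divergence, every term of the third momentum equation except the pressure is itself a
divergence. After multiplication by the cutoff only derivatives of the cutoff remain, and the integral grows at most linearly in \<open>R\<close>.\<close>

lemma integral_cutoff_partial_3_p:
  assumes R: "0 < R"
  shows "integral (cell R) (\<lambda>x. cutoff R x * partial 3 p x)
    = integral (cell R) (\<lambda>x. u x $ 3 * laplacian_cutoff R x
        + cutoff_slope R x * (u x $ 3 * radial_moment u x - h x $ 3 * radial_moment h x))"
proof (rule integral_eq_modulo_divergence)
  let ?F = "\<lambda>i x. cutoff R x * partial i u x $ 3 - u x $ 3 * (hor i x * cutoff_slope R x)
      - cutoff R x * (u x $ i * u x $ 3) + cutoff R x * (h x $ i * h x $ 3)"
  let ?F' = "\<lambda>i x. (cutoff R x * partial i (partial i u) x $ 3 + (hor i x * cutoff_slope R x) * partial i u x $ 3)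
     - (u x $ 3 * ((if i = 3 then 0 else 1) * cutoff_slope R x + (hor i x)\<^sup>2 * cutoff_curv R x) + partial i u x $ 3 * (hor i x * cutoff_slope R x))
     - (cutoff R x * (u x $ i * partial i u x $ 3 + partial i u x $ i * u x $ 3) + (hor i x * cutoff_slope R x) * (u x $ i * u x $ 3))
     + (cutoff R x * (h x $ i * partial i h x $ 3 + partial i h x $ i * h x $ 3) + (hor i x * cutoff_slope R x) * (h x $ i * h x $ 3))"
  show "deriv_along i (?F i) (?F' i)" for i
    by (intro deriv_along_add deriv_along_diff deriv_along_mult deriv_along_cutoff deriv_along_grad_cutoff
        deriv_along_component du dh ddu ddh)
  show "z_periodic (?F i)" for i
    by (intro z_periodic_intros per z_periodic_radial)
  show "?F i x = 0" if "R \<le> rad x" for i x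
    using cutoff_eq_0[OF R that] by simp
  show "cutoff R x * partial 3 p x = (\<Sum>i\<in>UNIV. ?F' i x) + (u x $ 3 * laplacian_cutoff R x
        + cutoff_slope R x * (u x $ 3 * radial_moment u x - h x $ 3 * radial_moment h x))" for x
    unfolding partial_3_p_eq sum_3 hor_simps if_eq_3 radial_moment_def laplacian_cutoff_def rad_sq
    using div_3[of x] by simp algebra
  show "continuous_on UNIV (\<lambda>x. u x $ 3 * laplacian_cutoff R x
        + cutoff_slope R x * (u x $ 3 * radial_moment u x - h x $ 3 * radial_moment h x))"
    by (intro continuous_intros continuous_cutoffs cont)
qed

lemma p_vertical_increment_const:
  obtains c where "\<And>x. p (x + (2 * pi) *\<^sub>R ez) - p x = c"
proof -
  have "((\<lambda>x. p (x + (2 * pi) *\<^sub>R ez) - p x) has_derivative (\<lambda>v. 0)) (at x)" for x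
  proof -
    have "((\<lambda>x. x + (2 * pi) *\<^sub>R ez) has_derivative (\<lambda>v. v)) (at x)"
      by (auto intro!: derivative_eq_intros)
    from has_derivative_compose[OF this smooth_has_derivative[OF smooth_p]]
    have "((\<lambda>x. p (x + (2 * pi) *\<^sub>R ez)) has_derivative (\<lambda>v. \<Sum>i\<in>UNIV. v $ i *\<^sub>R partial i p x)) (at x)"
      using z_periodic_2pi[OF per_gradient_p] by simp
    from has_derivative_diff[OF this smooth_has_derivative[OF smooth_p]]
    show ?thesis by simp
  qed
  then obtain c where "\<forall>x\<in>UNIV. p (x + (2 * pi) *\<^sub>R ez) - p x = c"
    using has_derivative_zero_constant[OF convex_UNIV, of "\<lambda>x. p (x + (2 * pi) *\<^sub>R ez) - p x"] by auto
  then have "\<And>x. p (x + (2 * pi) *\<^sub>R ez) - p x = c" by simp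
  then show thesis by (rule that)
qed

text \<open>If \<open>p\<close> increased by \<open>c\<close> over a period, the vertical mean of \<open>\<partial>\<^sub>3 p\<close> would be \<open>c / (2\<pi>)\<close>, and its integral against the
cutoff would grow like \<open>c R\<^sup>2\<close>. The fields, bounded as they are, allow only linear growth.\<close>

lemma p_periodic: "z_periodic p"
proof -
  obtain c where c: "\<And>x. p (x + (2 * pi) *\<^sub>R ez) - p x = c"
    using p_vertical_increment_const by blast
  obtain B where B1: "1 \<le> B" and B: "\<And>x R. x \<in> cell R \<Longrightarrow> field_sq x \<le> B"
    using bounded_on_cells[OF field_sq_cont field_sq_decay] by blast
  have bound: "\<bar>c\<bar> \<le> 128 * (36 * B + 12 * B\<^sup>2) * pi / R" if R1: "1 \<le> R" for R
  proof -
    have R: "0 < R" using R1 by simp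
    let ?Y = "\<lambda>x. u x $ 3 * laplacian_cutoff R x
        + cutoff_slope R x * (u x $ 3 * radial_moment u x - h x $ 3 * radial_moment h x)"
    \<comment> \<open>The two summands come from the Laplacian of the cutoff, at most \<open>36 / R\<^sup>2 \<le> 36 / R\<close>, and from its slope, at most \<open>6 / R\<^sup>2\<close>,
    times two products of a component, at most \<open>B\<close>, and a radial moment, at most \<open>R * B\<close>.\<close>
    define K where "K = (36 * B + 12 * B\<^sup>2) / R"
    have K: "0 \<le> K" using R B1 by (simp add: K_def)
    have Yb: "\<bar>?Y x\<bar> \<le> K" if x: "x \<in> cell R" for x
    proof -
      have nrm: "norm w \<le> B" if "(norm w)\<^sup>2 \<le> field_sq x" for w :: "real^3"
      proof -
        have "(norm w)\<^sup>2 \<le> B\<^sup>2"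
          using that B[OF x] mult_left_mono[OF B1, of B] B1 unfolding power2_eq_square[of B] by linarith
        then show ?thesis by (rule power2_le_imp_le) (use B1 in simp)
      qed
      have c3: "\<bar>w $ 3\<bar> \<le> B" if "(norm w)\<^sup>2 \<le> field_sq x" for w :: "real^3"
        using component_le_norm_cart[of w 3] nrm[OF that] by linarith
      have rm: "\<bar>radial_moment v x\<bar> \<le> R * B" if "(norm (v x))\<^sup>2 \<le> field_sq x" for v :: "real^3 \<Rightarrow> real^3"
        using order_trans[OF abs_radial_moment_le[of v x] mult_mono[OF rad_le_cell[OF x] nrm[of "v x"]]] that R by simp
      have "\<bar>u x $ 3 * laplacian_cutoff R x\<bar> \<le> B * (36 / R\<^sup>2)"
        unfolding abs_mult using B1
        by (intro mult_mono c3[OF norm_u_sq_le] abs_laplacian_cutoff_le[OF R rad_le_cell[OF x]]) auto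
      also have "\<dots> \<le> 36 * B / R"
        using mult_left_mono[OF R1, of B] R B1 by (simp add: field_simps power2_eq_square)
      finally have 1: "\<bar>u x $ 3 * laplacian_cutoff R x\<bar> \<le> 36 * B / R" .
      have "\<bar>u x $ 3 * radial_moment u x\<bar> \<le> B * (R * B)"
        unfolding abs_mult using B1 by (intro mult_mono c3[OF norm_u_sq_le] rm[of u, OF norm_u_sq_le]) auto
      moreover have "\<bar>h x $ 3 * radial_moment h x\<bar> \<le> B * (R * B)"
        unfolding abs_mult using B1 by (intro mult_mono c3[OF norm_h_sq_le] rm[of h, OF norm_h_sq_le]) auto
      ultimately have "\<bar>u x $ 3 * radial_moment u x - h x $ 3 * radial_moment h x\<bar> \<le> 2 * (B * (R * B))"
        by linarith
      then have "\<bar>cutoff_slope R x * (u x $ 3 * radial_moment u x - h x $ 3 * radial_moment h x)\<bar> \<le> 6 / R\<^sup>2 * (2 * (B * (R * B)))"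
        unfolding abs_mult using R by (intro mult_mono cutoff_bounds(3)[OF R]) auto
      also have "\<dots> = 12 * B\<^sup>2 / R"
        using R by (simp add: power2_eq_square)
      finally show ?thesis
        unfolding K_def add_divide_distrib by (intro order_trans[OF abs_triangle_ineq] add_mono 1)
    qed
    have Yc: "continuous_on UNIV ?Y"
      by (intro continuous_intros continuous_cutoffs cont)
    have "\<bar>integral (cell R) ?Y\<bar> \<le> integral (cell R) (\<lambda>x. K)"
      by (intro abs_integral_cell_le Yc Yb continuous_on_const)
    also have "\<dots> = K * integral (cell R) (\<lambda>x. 1)"
      by (subst integral_mult_right[symmetric]) simp
    also have "\<dots> \<le> K * (8 * pi * R\<^sup>2)"
      using R K by (intro mult_left_mono volume_cell_le) auto
    finally have Y: "\<bar>integral (cell R) ?Y\<bar> \<le> K * (8 * pi * R\<^sup>2)" .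
    define H where "H x = cutoff R x * partial 3 p x" for x
    have Hc: "continuous_on UNIV H"
      unfolding H_def by (intro continuous_intros continuous_cutoffs cont)
    have Hp: "z_periodic H"
      unfolding H_def by (intro z_periodic_intros z_periodic_radial per_gradient_p)
    have "c * integral (cell R) (cutoff R) = integral (cell R) (\<lambda>x. cutoff R x * c)"
      by (subst integral_mult_right[symmetric]) (simp add: mult.commute)
    also have "\<dots> = integral (cell R) (\<lambda>x. integral {0..2*pi} (\<lambda>s. H (x + s *\<^sub>R ez)))"
    proof (rule integral_cong)
      fix x
      have "integral {0..2*pi} (\<lambda>s. H (x + s *\<^sub>R ez)) = cutoff R x * integral {0..2*pi} (\<lambda>s. partial 3 p (x + s *\<^sub>R ez))"
        by (subst integral_mult_right[symmetric]) (simp add: H_def cutoff_def bump_def)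
      also have "integral {0..2*pi} (\<lambda>s. partial 3 p (x + s *\<^sub>R ez)) = c"
        using integral_deriv_along_line[OF dp[of 3], of 0 "2*pi" x] c[of x] by simp
      finally show "cutoff R x * c = integral {0..2*pi} (\<lambda>s. H (x + s *\<^sub>R ez))" ..
    qed
    also have "\<dots> = integral {0..2*pi} (\<lambda>s. integral (cell R) (\<lambda>x. H (x + s *\<^sub>R ez)))"
      unfolding cell_def by (rule integral_slab_swap(1)[OF continuous_line_param[OF Hc]])
    also have "\<dots> = integral {0..2*pi} (\<lambda>s. integral (cell R) H)"
      by (intro integral_cong integral_cell_translate[OF Hc Hp]) auto
    also have "\<dots> = 2 * pi * integral (cell R) ?Y"
      using integral_cutoff_partial_3_p[OF R] by (simp add: H_def[abs_def])
    finally have "\<bar>c * integral (cell R) (cutoff R)\<bar> = \<bar>2 * pi * integral (cell R) ?Y\<bar>"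
      by (rule arg_cong)
    moreover have "0 \<le> integral (cell R) (cutoff R)"
      by (intro integral_nonneg integrable_cell continuous_cutoffs) (simp add: cutoff_bounds R)
    ultimately have "\<bar>c\<bar> * integral (cell R) (cutoff R) = 2 * pi * \<bar>integral (cell R) ?Y\<bar>"
      unfolding abs_mult by simp
    moreover have "\<bar>c\<bar> * (pi * R\<^sup>2 / 8) \<le> \<bar>c\<bar> * integral (cell R) (cutoff R)"
      by (intro mult_left_mono integral_cutoff_ge R) auto
    moreover have "2 * pi * \<bar>integral (cell R) ?Y\<bar> \<le> 2 * pi * (K * (8 * pi * R\<^sup>2))"
      by (intro mult_left_mono Y) auto
    ultimately have "\<bar>c\<bar> * (pi * R\<^sup>2 / 8) \<le> 2 * pi * (K * (8 * pi * R\<^sup>2))" by linarith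
    then have "(pi * R\<^sup>2 / 8) * \<bar>c\<bar> \<le> (pi * R\<^sup>2 / 8) * (128 * K * pi)"
      by (simp add: algebra_simps)
    moreover have "0 < pi * R\<^sup>2 / 8" using R by simp
    ultimately have "\<bar>c\<bar> \<le> 128 * K * pi" by (meson mult_le_cancel_left_pos)
    then show ?thesis by (simp add: K_def)
  qed
  have "((\<lambda>R. 128 * (36 * B + 12 * B\<^sup>2) * pi / R) \<longlongrightarrow> 0) at_top"
    by (intro tendsto_divide_0[OF tendsto_const] filterlim_at_top_imp_at_infinity filterlim_ident)
  moreover have "\<forall>\<^sub>F R in at_top. \<bar>c\<bar> \<le> 128 * (36 * B + 12 * B\<^sup>2) * pi / R"
    using eventually_ge_at_top[of 1] by eventually_elim (rule bound)
  ultimately have "\<bar>c\<bar> \<le> 0"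
    by (intro tendsto_lowerbound) auto
  moreover have "axis 3 (2 * pi) = (2 * pi) *\<^sub>R ez"
    by (simp add: vec_eq_iff axis_def)
  ultimately show ?thesis
    using c by (simp add: z_periodic_def)
qed

text \<open>The flux consists of the gradient of the energy density, its transport and that of the pressure by \<open>u\<close>, and the transport
of \<open>u \<bullet> h\<close> by \<open>h\<close>. The latter arises because the magnetic tension in the momentum equation and the stretching term in the induction
equation, tested with \<open>u\<close> and \<open>h\<close>, add up to \<open>(h \<bullet> \<nabla>)(u \<bullet> h)\<close>.\<close>

lemma energy_identity:
  assumes R: "0 < R"
  shows "integral (cell R) (\<lambda>x. grad_sq x * cutoff R x)
    = integral (cell R) (\<lambda>x. field_sq x / 2 * laplacian_cutoff R x + (field_sq x / 2 + p x) * cutoff_slope R x * radial_moment u x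
        - (u x \<bullet> h x) * cutoff_slope R x * radial_moment h x)"
proof (rule integral_eq_modulo_divergence)
  define a where "a i x = u x \<bullet> partial i u x + h x \<bullet> partial i h x" for i x
  define b where "b i x = (u x \<bullet> partial i (partial i u) x + partial i u x \<bullet> partial i u x)
      + (h x \<bullet> partial i (partial i h) x + partial i h x \<bullet> partial i h x)" for i x
  define d where "d i x = u x \<bullet> partial i h x + partial i u x \<bullet> h x" for i x
  have da: "deriv_along i (a i) (b i)" for i
    unfolding a_def[abs_def] b_def[abs_def] by (intro deriv_along_add deriv_along_inner du dh ddu ddh)
  have dE: "deriv_along i (\<lambda>x. field_sq x / 2) (a i)" for i
  proof -
    have "deriv_along i (\<lambda>x. 1 / 2 * (u x \<bullet> u x + h x \<bullet> h x))
      (\<lambda>x. 1 / 2 * ((u x \<bullet> partial i u x + partial i u x \<bullet> u x) + (h x \<bullet> partial i h x + partial i h x \<bullet> h x)) + 0 * (u x \<bullet> u x + h x \<bullet> h x))"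
      by (intro deriv_along_mult deriv_along_const deriv_along_add deriv_along_inner du dh)
    moreover have "(\<lambda>x. 1 / 2 * ((u x \<bullet> partial i u x + partial i u x \<bullet> u x) + (h x \<bullet> partial i h x + partial i h x \<bullet> h x)) + 0 * (u x \<bullet> u x + h x \<bullet> h x)) = a i"
      by (auto simp: a_def inner_commute)
    ultimately show ?thesis by (simp add: field_sq_def)
  qed
  have dS: "deriv_along i (\<lambda>x. u x \<bullet> h x) (d i)" for i
    unfolding d_def[abs_def] by (intro deriv_along_inner du dh)
  let ?F = "\<lambda>i x. a i x * cutoff R x - field_sq x / 2 * (hor i x * cutoff_slope R x)
     - u x $ i * (field_sq x / 2 + p x) * cutoff R x + h x $ i * (u x \<bullet> h x) * cutoff R x"
  let ?F' = "\<lambda>i x. (a i x * (hor i x * cutoff_slope R x) + b i x * cutoff R x)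
     - (field_sq x / 2 * ((if i = 3 then 0 else 1) * cutoff_slope R x + (hor i x)\<^sup>2 * cutoff_curv R x) + a i x * (hor i x * cutoff_slope R x))
     - (u x $ i * (field_sq x / 2 + p x) * (hor i x * cutoff_slope R x)
         + (u x $ i * (a i x + partial i p x) + partial i u x $ i * (field_sq x / 2 + p x)) * cutoff R x)
     + (h x $ i * (u x \<bullet> h x) * (hor i x * cutoff_slope R x)
         + (h x $ i * d i x + partial i h x $ i * (u x \<bullet> h x)) * cutoff R x)"
  show "deriv_along i (?F i) (?F' i)" for i
    by (intro deriv_along_add deriv_along_diff deriv_along_mult deriv_along_cutoff deriv_along_grad_cutoff
        deriv_along_component du dh dp da dE dS)
  show "z_periodic (?F i)" for i
    unfolding a_def field_sq_def divide_inverse by (intro z_periodic_intros per p_periodic z_periodic_radial)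
  show "?F i x = 0" if "R \<le> rad x" for i x
    using cutoff_eq_0[OF R that] by simp
  show "continuous_on UNIV (\<lambda>x. field_sq x / 2 * laplacian_cutoff R x + (field_sq x / 2 + p x) * cutoff_slope R x * radial_moment u x
        - (u x \<bullet> h x) * cutoff_slope R x * radial_moment h x)"
    unfolding divide_inverse by (intro continuous_intros continuous_cutoffs cont field_sq_cont)
  show "grad_sq x * cutoff R x = (\<Sum>i\<in>UNIV. ?F' i x) + (field_sq x / 2 * laplacian_cutoff R x + (field_sq x / 2 + p x) * cutoff_slope R x * radial_moment u x
        - (u x \<bullet> h x) * cutoff_slope R x * radial_moment h x)" for x
  proof -
    \<comment> \<open>The equations tested with the fields: the sum of the \<open>b i\<close>, the Laplacian of the energy density, differs from the
    Dirichlet density by transport terms only.\<close>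
    have "u x \<bullet> (advect u u x + gradient p x - advect h h x - laplacian u x)
        + h x \<bullet> (advect u h x - advect h u x - laplacian h x) = 0"
      unfolding momentum induction_eq by simp
    moreover have "u x \<bullet> gradient p x = (\<Sum>i\<in>UNIV. u x $ i * partial i p x)"
      by (simp add: inner_vec_def gradient_def)
    ultimately have bal: "(\<Sum>i\<in>UNIV. b i x) - grad_sq x = (\<Sum>i\<in>UNIV. u x $ i * (a i x + partial i p x)) - (\<Sum>i\<in>UNIV. h x $ i * d i x)"
      unfolding a_def b_def d_def grad_sq_def advect_def laplacian_def
      by (simp add: inner_add_right inner_diff_right inner_sum_right sum.distrib distrib_left sum_subtractf
          inner_commute algebra_simps)
    define E where "E = field_sq x / 2"
    have grad_sq: "grad_sq x = b 1 x + b 2 x + b 3 x - (u x $ 1 * (a 1 x + partial 1 p x) + u x $ 2 * (a 2 x + partial 2 p x)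
        + u x $ 3 * (a 3 x + partial 3 p x) - (h x $ 1 * d 1 x + h x $ 2 * d 2 x + h x $ 3 * d 3 x))"
      using bal unfolding sum_3 by linarith
    have D: "partial 3 u x $ 3 = - partial 1 u x $ 1 - partial 2 u x $ 2"
      "partial 3 h x $ 3 = - partial 1 h x $ 1 - partial 2 h x $ 2"
      using div_3[of x] by linarith+
    show ?thesis
      unfolding sum_3 hor_simps if_eq_3 radial_moment_def laplacian_cutoff_def rad_sq E_def[symmetric] grad_sq D
      by (simp add: algebra_simps)
  qed
qed

section \<open>Bounds for the drift and the pressure\<close>

text \<open>By translation invariance a pointwise bound may mix values at \<open>x\<close> with values at a vertical translate of \<open>x\<close>.\<close>

lemma abs_integral_le_energy:
  assumes X: "continuous_on UNIV X" and s: "0 \<le> s" "s \<le> 2 * pi"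
    and nn: "0 \<le> a" "0 \<le> b"
    and le: "\<And>x. x \<in> cell R \<Longrightarrow> \<bar>X x\<bar> \<le> a * grad_sq x + b * grad_sq (x + s *\<^sub>R ez) + c * field_sq x + d * field_sq (x + s *\<^sub>R ez)"
  shows "\<bar>integral (cell R) X\<bar> \<le> (a + b) * D + (c + d) * integral (cell R) field_sq"
proof -
  note Gs = continuous_shift[OF grad_sq_cont] and Ns = continuous_shift[OF field_sq_cont]
  have "\<bar>integral (cell R) X\<bar> \<le> integral (cell R) (\<lambda>x. a * grad_sq x + b * grad_sq (x + s *\<^sub>R ez) + c * field_sq x + d * field_sq (x + s *\<^sub>R ez))"
    by (intro abs_integral_cell_le X continuous_on_add continuous_on_mult continuous_on_const grad_sq_cont field_sq_cont Gs Ns le)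
  also have "\<dots> = a * integral (cell R) grad_sq + b * integral (cell R) (\<lambda>x. grad_sq (x + s *\<^sub>R ez))
      + c * integral (cell R) field_sq + d * integral (cell R) (\<lambda>x. field_sq (x + s *\<^sub>R ez))"
    by (simp add: integral_add integrable_cell continuous_on_add continuous_on_mult continuous_on_const grad_sq_cont field_sq_cont Gs Ns)
  also have "\<dots> = (a + b) * integral (cell R) grad_sq + (c + d) * integral (cell R) field_sq"
    by (simp add: integral_cell_translate[OF grad_sq_cont grad_sq_per s] integral_cell_translate[OF field_sq_cont field_sq_per s] algebra_simps)
  also have "\<dots> \<le> (a + b) * D + (c + d) * integral (cell R) field_sq"
    using nn dirichlet[of R] by (intro add_right_mono mult_left_mono) (auto simp: grad_sq_def[abs_def])
  finally show ?thesis .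
qed

lemma norm_partial_sq_le:
  "(norm (partial i u x))\<^sup>2 \<le> grad_sq x" "(norm (partial i h x))\<^sup>2 \<le> grad_sq x"
proof -
  have "(norm (partial i u x))\<^sup>2 + (norm (partial i h x))\<^sup>2 \<le> grad_sq x"
    unfolding grad_sq_def power2_norm_eq_inner by (rule member_le_sum) auto
  then show "(norm (partial i u x))\<^sup>2 \<le> grad_sq x" "(norm (partial i h x))\<^sup>2 \<le> grad_sq x"
    using zero_le_power2[of "norm (partial i u x)"] zero_le_power2[of "norm (partial i h x)"] by linarith+
qed

text \<open>After the exchange for a translate of \<open>\<partial>\<^sub>3v\<close>, the integrand is at most \<open>3 (\<bar>u\<bar>\<^sup>2 + \<bar>h\<bar>\<^sup>2) / R\<close> times the size of a gradient.
Splitting with the parameter \<open>d\<close> leaves \<open>d\<close> times the Dirichlet integral and, since the fields are bounded, a mean square.\<close>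

lemma drift_bound:
  assumes R: "0 < R" and d: "0 < d" and B: "\<And>x. x \<in> cell R \<Longrightarrow> field_sq x \<le> B"
    and v: "smooth v" "swirl_free v" "\<And>x. divergence v x = 0" "z_periodic v"
    and vG: "\<And>x. (norm (partial 3 v x))\<^sup>2 \<le> grad_sq x"
    and X: "continuous_on UNIV X" "\<And>x. \<bar>X x\<bar> \<le> field_sq x / 2"
  shows "\<bar>integral (cell R) (\<lambda>x. X x * cutoff_slope R x * radial_moment v x)\<bar>
     \<le> pi * (3 / 2 * d * D + 3 / 2 * B / (d * R\<^sup>2) * integral (cell R) field_sq)"
proof (rule integral_radial_moment_bound[OF v])
  show c: "continuous_on UNIV (\<lambda>x. X x * cutoff_slope R x)"
    by (intro continuous_intros X continuous_cutoffs)
  fix s :: real assume s: "0 \<le> s" "s \<le> 2 * pi"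
  have "\<bar>integral (cell R) (\<lambda>x. X x * cutoff_slope R x * radial_moment (partial 3 v) (x + s *\<^sub>R ez))\<bar>
    \<le> (0 + 3 / 2 * d) * D + (3 / 2 * B / (d * R\<^sup>2) + 0) * integral (cell R) field_sq"
  proof (rule abs_integral_le_energy[OF _ s])
    show "continuous_on UNIV (\<lambda>x. X x * cutoff_slope R x * radial_moment (partial 3 v) (x + s *\<^sub>R ez))"
      by (intro continuous_on_mult c continuous_shift continuous_radial_moment smooth_continuous smooth_partial v)
    fix x assume x: "x \<in> cell R"
    define m where "m = norm (partial 3 v (x + s *\<^sub>R ez))"
    have rm: "\<bar>radial_moment (partial 3 v) (x + s *\<^sub>R ez)\<bar> \<le> R * m"
      using order_trans[OF abs_radial_moment_le[of "partial 3 v" "x + s *\<^sub>R ez"] mult_right_mono[OF _ norm_ge_zero]] rad_le_cell[OF x]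
      by (simp add: m_def)
    have "\<bar>X x * cutoff_slope R x * radial_moment (partial 3 v) (x + s *\<^sub>R ez)\<bar> \<le> (field_sq x / 2) * (6 / R\<^sup>2) * (R * m)"
      unfolding abs_mult using R field_sq_nonneg[of x]
      by (intro mult_mono X(2) cutoff_bounds(3)[OF R] rm) auto
    also have "\<dots> = 3 * (m * (field_sq x / R))"
      using R by (simp add: power2_eq_square)
    also have "\<dots> \<le> 3 * ((d * m\<^sup>2 + (field_sq x / R)\<^sup>2 / d) / 2)"
      by (intro mult_left_mono weighted_amgm d) auto
    also have "\<dots> = 3 / 2 * d * m\<^sup>2 + 3 / 2 * (field_sq x * field_sq x) / (d * R\<^sup>2)"
      using R d by (simp add: power2_eq_square field_simps)
    also have "\<dots> \<le> 3 / 2 * d * grad_sq (x + s *\<^sub>R ez) + 3 / 2 * (B * field_sq x) / (d * R\<^sup>2)"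
      using R d vG[of "x + s *\<^sub>R ez"] field_sq_nonneg[of x] B[OF x]
      by (intro add_mono mult_left_mono divide_right_mono mult_right_mono) (auto simp: m_def)
    finally show "\<bar>X x * cutoff_slope R x * radial_moment (partial 3 v) (x + s *\<^sub>R ez)\<bar>
       \<le> 0 * grad_sq x + 3 / 2 * d * grad_sq (x + s *\<^sub>R ez) + 3 / 2 * B / (d * R\<^sup>2) * field_sq x + 0 * field_sq (x + s *\<^sub>R ez)"
      by simp
  qed (use d in auto)
  then show "\<bar>integral (cell R) (\<lambda>x. X x * cutoff_slope R x * radial_moment (partial 3 v) (x + s *\<^sub>R ez))\<bar>
    \<le> 3 / 2 * d * D + 3 / 2 * B / (d * R\<^sup>2) * integral (cell R) field_sq" by simp
qed

text \<open>Here \<open>q\<close> is the product against which \<open>\<partial>\<^sub>3 p\<close> is tested and \<open>q' i\<close> is its \<open>i\<close>-th derivative. The left-hand side is what remains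
of that pairing after the second-order part of \<open>\<partial>\<^sub>3 p\<close> has been integrated by parts. The viscous part pairs two gradients
with a factor \<open>1 / R\<close>, which is harmless; only the convective part, with one gradient and two undifferentiated fields, needs the
parameter \<open>d\<close>.\<close>

lemma pressure_pairing_pointwise_bound:
  fixes s :: real
  assumes R: "0 < R" and d: "0 < d" and B: "\<And>x. x \<in> cell R \<Longrightarrow> field_sq x \<le> B" and x: "x \<in> cell R"
  defines "q \<equiv> \<lambda>y. cutoff_slope R y * radial_moment u (y + s *\<^sub>R ez)"
    and "q' \<equiv> \<lambda>i y. cutoff_slope R y * (radial_moment (partial i u) (y + s *\<^sub>R ez) + (if i = 3 then 0 else u (y + s *\<^sub>R ez) $ i))
          + hor i y * cutoff_curv R y * radial_moment u (y + s *\<^sub>R ez)"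
  shows "\<bar>\<Sum>i\<in>UNIV. (h x $ i * partial i h x $ 3 - u x $ i * partial i u x $ 3) * q x - partial i u x $ 3 * q' i x\<bar>
    \<le> (3 / R + 15 / R\<^sup>2 + 3 * d) * grad_sq x + 3 / R * grad_sq (x + s *\<^sub>R ez) + 0 * field_sq x
      + (45 / R\<^sup>2 + 18 * B / (d * R\<^sup>2)) * field_sq (x + s *\<^sub>R ez)"
proof -
  define y where "y = x + s *\<^sub>R ez"
  define m where "m = norm (u y)"
  define a where "a i = norm (partial i u x)" for i
  define b where "b i = norm (partial i h x)" for i
  define a' where "a' i = norm (partial i u y)" for i
  have ry: "rad y \<le> R" using rad_le_cell[OF x] by (simp add: y_def)
  have nn: "0 \<le> m" "0 \<le> a i" "0 \<le> b i" "0 \<le> a' i" for i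
    by (auto simp: m_def a_def b_def a'_def)
  have hor_le: "\<bar>hor i x\<bar> \<le> R" for i
    using abs_component_le_rad[of x] rad_le_cell[OF x] R exhaust_3[of i] by (auto simp: hor_simps)
  have W: "\<bar>radial_moment u y\<bar> \<le> R * m"
    using order_trans[OF abs_radial_moment_le[of u y] mult_right_mono[OF ry norm_ge_zero]] by (simp add: m_def)
  have DW: "\<bar>radial_moment (partial i u) y\<bar> \<le> R * a' i" for i
    using order_trans[OF abs_radial_moment_le[of "partial i u" y] mult_right_mono[OF ry norm_ge_zero]] by (simp add: a'_def)
  have q: "\<bar>q x\<bar> \<le> 6 / R\<^sup>2 * (R * m)"
    unfolding q_def abs_mult y_def[symmetric] using R
    by (intro mult_mono cutoff_bounds(3)[OF R] W) auto
  have q': "\<bar>q' i x\<bar> \<le> 6 / R\<^sup>2 * (R * a' i + m) + R * (24 / R ^ 4) * (R * m)" for i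
  proof -
    have "\<bar>radial_moment (partial i u) y + (if i = 3 then 0 else u y $ i)\<bar> \<le> R * a' i + m"
      using DW[of i] component_le_norm_cart[of "u y" i] nn(1)
      by (intro order_trans[OF abs_triangle_ineq] add_mono) (auto simp: m_def)
    then have "\<bar>cutoff_slope R x * (radial_moment (partial i u) y + (if i = 3 then 0 else u y $ i))\<bar> \<le> 6 / R\<^sup>2 * (R * a' i + m)"
      unfolding abs_mult using R by (intro mult_mono cutoff_bounds(3)[OF R]) auto
    moreover have "\<bar>hor i x * cutoff_curv R x * radial_moment u y\<bar> \<le> R * (24 / R ^ 4) * (R * m)"
      unfolding abs_mult using R by (intro mult_mono hor_le cutoff_bounds(4)[OF R] W) auto
    ultimately show ?thesis
      unfolding q'_def y_def[symmetric] by (intro order_trans[OF abs_triangle_ineq] add_mono)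
  qed
  have Nx: "(norm (u x))\<^sup>2 \<le> B" "(norm (h x))\<^sup>2 \<le> B"
    using norm_u_sq_le[of x] norm_h_sq_le[of x] B[OF x] by linarith+
  have convective: "\<bar>w x $ i * z $ 3 * q x\<bar> \<le> 3 * d * (norm z)\<^sup>2 + 3 * B * m\<^sup>2 / (d * R\<^sup>2)"
    if w: "(norm (w x))\<^sup>2 \<le> B" for w :: "real^3 \<Rightarrow> real^3" and z :: "real^3" and i
  proof -
    have "\<bar>w x $ i * z $ 3 * q x\<bar> \<le> norm (w x) * norm z * (6 / R\<^sup>2 * (R * m))"
      unfolding abs_mult using R nn(1)
      by (intro mult_mono component_le_norm_cart q) auto
    also have "\<dots> = 6 * (norm z * (norm (w x) * m / R))"
      using R by (simp add: power2_eq_square)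
    also have "\<dots> \<le> 6 * ((d * (norm z)\<^sup>2 + (norm (w x) * m / R)\<^sup>2 / d) / 2)"
      by (intro mult_left_mono weighted_amgm d) auto
    also have "\<dots> = 3 * d * (norm z)\<^sup>2 + 3 * ((norm (w x))\<^sup>2 * m\<^sup>2) / (d * R\<^sup>2)"
      using R d by (simp add: power2_eq_square field_simps)
    also have "\<dots> \<le> 3 * d * (norm z)\<^sup>2 + 3 * (B * m\<^sup>2) / (d * R\<^sup>2)"
      using R d w by (intro add_mono mult_left_mono divide_right_mono mult_right_mono) auto
    finally show ?thesis by simp
  qed
  have viscous: "\<bar>partial i u x $ 3 * q' i x\<bar> \<le> 3 / R * ((a i)\<^sup>2 + (a' i)\<^sup>2) + 15 / R\<^sup>2 * ((a i)\<^sup>2 + m\<^sup>2)" for i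
  proof -
    have am: "2 * (r * t) \<le> r\<^sup>2 + t\<^sup>2" for r t :: real
      using sum_squares_bound[of r t] by simp
    have "\<bar>partial i u x $ 3 * q' i x\<bar> \<le> a i * (6 / R\<^sup>2 * (R * a' i + m) + R * (24 / R ^ 4) * (R * m))"
      unfolding abs_mult a_def using q'[of i] component_le_norm_cart[of "partial i u x" 3]
      by (intro mult_mono) auto
    also have "\<dots> = 3 / R * (2 * (a i * a' i)) + 15 / R\<^sup>2 * (2 * (a i * m))"
      using R by (simp add: field_simps power2_eq_square power4_eq_xxxx)
    also have "\<dots> \<le> 3 / R * ((a i)\<^sup>2 + (a' i)\<^sup>2) + 15 / R\<^sup>2 * ((a i)\<^sup>2 + m\<^sup>2)"
      using R by (intro add_mono mult_left_mono am) auto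
    finally show ?thesis .
  qed
  have each: "\<bar>(h x $ i * partial i h x $ 3 - u x $ i * partial i u x $ 3) * q x - partial i u x $ 3 * q' i x\<bar>
    \<le> (3 / R + 15 / R\<^sup>2 + 3 * d) * ((a i)\<^sup>2 + (b i)\<^sup>2) + 3 / R * (a' i)\<^sup>2 + (15 / R\<^sup>2 + 6 * B / (d * R\<^sup>2)) * m\<^sup>2" for i
  proof -
    have "\<bar>(h x $ i * partial i h x $ 3 - u x $ i * partial i u x $ 3) * q x - partial i u x $ 3 * q' i x\<bar>
      \<le> \<bar>h x $ i * partial i h x $ 3 * q x\<bar> + \<bar>u x $ i * partial i u x $ 3 * q x\<bar> + \<bar>partial i u x $ 3 * q' i x\<bar>"
      unfolding left_diff_distrib by linarith
    also have "\<dots> \<le> (3 * d * (b i)\<^sup>2 + 3 * B * m\<^sup>2 / (d * R\<^sup>2)) + (3 * d * (a i)\<^sup>2 + 3 * B * m\<^sup>2 / (d * R\<^sup>2))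
       + (3 / R * ((a i)\<^sup>2 + (a' i)\<^sup>2) + 15 / R\<^sup>2 * ((a i)\<^sup>2 + m\<^sup>2))"
      unfolding a_def b_def
      by (intro add_mono convective[of h] convective[of u] Nx viscous[unfolded a_def])
    also have "\<dots> \<le> \<dots> + (3 / R + 15 / R\<^sup>2) * (b i)\<^sup>2"
      using R by simp
    also have "\<dots> = (3 / R + 15 / R\<^sup>2 + 3 * d) * ((a i)\<^sup>2 + (b i)\<^sup>2) + 3 / R * (a' i)\<^sup>2 + (15 / R\<^sup>2 + 6 * B / (d * R\<^sup>2)) * m\<^sup>2"
      by (simp add: algebra_simps)
    finally show ?thesis .
  qed
  have "\<bar>\<Sum>i\<in>UNIV. (h x $ i * partial i h x $ 3 - u x $ i * partial i u x $ 3) * q x - partial i u x $ 3 * q' i x\<bar>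
    \<le> (\<Sum>i\<in>UNIV. (3 / R + 15 / R\<^sup>2 + 3 * d) * ((a i)\<^sup>2 + (b i)\<^sup>2) + 3 / R * (a' i)\<^sup>2 + (15 / R\<^sup>2 + 6 * B / (d * R\<^sup>2)) * m\<^sup>2)"
    by (rule order_trans[OF sum_abs sum_mono[OF each]])
  also have "\<dots> = (3 / R + 15 / R\<^sup>2 + 3 * d) * (\<Sum>i\<in>UNIV. (a i)\<^sup>2 + (b i)\<^sup>2) + 3 / R * (\<Sum>i\<in>UNIV. (a' i)\<^sup>2)
     + 3 * ((15 / R\<^sup>2 + 6 * B / (d * R\<^sup>2)) * m\<^sup>2)"
    by (simp add: sum_3 algebra_simps)
  also have "(\<Sum>i\<in>UNIV. (a i)\<^sup>2 + (b i)\<^sup>2) = grad_sq x"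
    by (simp add: grad_sq_def a_def b_def power2_norm_eq_inner)
  also have "3 * ((15 / R\<^sup>2 + 6 * B / (d * R\<^sup>2)) * m\<^sup>2) = (45 / R\<^sup>2 + 18 * B / (d * R\<^sup>2)) * m\<^sup>2"
    by (simp add: algebra_simps)
  also have "(3 / R + 15 / R\<^sup>2 + 3 * d) * grad_sq x + 3 / R * (\<Sum>i\<in>UNIV. (a' i)\<^sup>2) + (45 / R\<^sup>2 + 18 * B / (d * R\<^sup>2)) * m\<^sup>2
    \<le> (3 / R + 15 / R\<^sup>2 + 3 * d) * grad_sq x + 3 / R * grad_sq y + (45 / R\<^sup>2 + 18 * B / (d * R\<^sup>2)) * field_sq y"
  proof (intro add_mono mult_left_mono order_refl)
    show "(\<Sum>i\<in>UNIV. (a' i)\<^sup>2) \<le> grad_sq y"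
      unfolding grad_sq_def a'_def power2_norm_eq_inner by (intro sum_mono) simp
    show "m\<^sup>2 \<le> field_sq y" using norm_u_sq_le by (simp add: m_def)
    have "0 \<le> B" using B[OF x] field_sq_nonneg[of x] by linarith
    then show "0 \<le> 45 / R\<^sup>2 + 18 * B / (d * R\<^sup>2)" using d R by simp
  qed (use R d in auto)
  finally show ?thesis by (simp add: y_def)
qed

text \<open>The exchange puts a vertical derivative on the radial moment, a first integration by parts moves it to the pressure, and a second
one, after inserting the momentum equation, removes the second derivatives of \<open>u\<close>.\<close>

lemma pressure_bound:
  assumes R: "0 < R" and d: "0 < d" and B: "\<And>x. x \<in> cell R \<Longrightarrow> field_sq x \<le> B"
  shows "\<bar>integral (cell R) (\<lambda>x. p x * cutoff_slope R x * radial_moment u x)\<bar>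
     \<le> pi * ((6 / R + 15 / R\<^sup>2 + 3 * d) * D + (45 / R\<^sup>2 + 18 * B / (d * R\<^sup>2)) * integral (cell R) field_sq)"
proof (rule integral_radial_moment_bound[OF smooth_u swirl_u div_u per_u])
  show "continuous_on UNIV (\<lambda>x. p x * cutoff_slope R x)"
    by (intro continuous_on_mult cont continuous_cutoffs)
  fix s :: real assume s: "0 \<le> s" "s \<le> 2 * pi"
  define q where "q = (\<lambda>y. cutoff_slope R y * radial_moment u (y + s *\<^sub>R ez))"
  define q' where "q' = (\<lambda>i y. cutoff_slope R y * (radial_moment (partial i u) (y + s *\<^sub>R ez) + (if i = 3 then 0 else u (y + s *\<^sub>R ez) $ i))
          + hor i y * cutoff_curv R y * radial_moment u (y + s *\<^sub>R ez))"
  have dq: "deriv_along i q (q' i)" for i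
    unfolding q_def q'_def
    by (rule deriv_along_mult[OF deriv_along_cutoff_slope deriv_along_shift[OF deriv_along_radial_moment[OF smooth_u]]])
  have qper: "z_periodic q"
    unfolding q_def by (intro z_periodic_mult z_periodic_radial z_periodic_shift z_periodic_radial_moment per)
  have q0: "q x = 0" if "R \<le> rad x" for x
    using cutoff_eq_0[OF R that] by (simp add: q_def)
  note qc = deriv_along_cont[OF dq]
  let ?Y = "\<lambda>x. \<Sum>i\<in>UNIV. (h x $ i * partial i h x $ 3 - u x $ i * partial i u x $ 3) * q x - partial i u x $ 3 * q' i x"
  have Yc: "continuous_on UNIV ?Y"
    by (intro continuous_on_sum continuous_on_diff continuous_on_mult continuous_on_component cont qc)
  have q3: "p x * cutoff_slope R x * radial_moment (partial 3 u) (x + s *\<^sub>R ez) = p x * q' 3 x" for x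
    by (simp add: q'_def hor_simps)
  have "integral (cell R) (\<lambda>x. p x * q' 3 x + partial 3 p x * q x) = 0"
    by (rule integral_deriv_along_eq_0[OF deriv_along_mult[OF dp dq]])
       (auto intro!: z_periodic_mult p_periodic qper simp: q0)
  moreover have "integral (cell R) (\<lambda>x. p x * q' 3 x + partial 3 p x * q x)
     = integral (cell R) (\<lambda>x. p x * q' 3 x) + integral (cell R) (\<lambda>x. partial 3 p x * q x)"
    by (intro integral_add integrable_cell continuous_on_mult cont qc)
  moreover have "integral (cell R) (\<lambda>x. partial 3 p x * q x) = integral (cell R) ?Y"
  proof (rule integral_eq_modulo_divergence)
    show "deriv_along i (\<lambda>x. partial i u x $ 3 * q x) (\<lambda>x. partial i u x $ 3 * q' i x + partial i (partial i u) x $ 3 * q x)" for i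
      by (intro deriv_along_mult deriv_along_component ddu dq)
    show "z_periodic (\<lambda>x. partial i u x $ 3 * q x)" for i
      by (intro z_periodic_mult z_periodic_component per qper)
    show "partial i u x $ 3 * q x = 0" if "R \<le> rad x" for i x
      using q0[OF that] by simp
    show "partial 3 p x * q x = (\<Sum>i\<in>UNIV. partial i u x $ 3 * q' i x + partial i (partial i u) x $ 3 * q x) + ?Y x" for x
      unfolding partial_3_p_eq sum_distrib_right sum.distrib[symmetric]
      by (intro sum.cong) (auto simp: algebra_simps)
  qed (rule Yc)
  ultimately have "\<bar>integral (cell R) (\<lambda>x. p x * q' 3 x)\<bar> = \<bar>integral (cell R) ?Y\<bar>"
    by linarith
  also have "\<dots> \<le> ((3 / R + 15 / R\<^sup>2 + 3 * d) + 3 / R) * D + (0 + (45 / R\<^sup>2 + 18 * B / (d * R\<^sup>2))) * integral (cell R) field_sq"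
    by (rule abs_integral_le_energy[OF Yc s])
       (use R d pressure_pairing_pointwise_bound[OF R d B] in \<open>auto simp: q_def q'_def\<close>)
  also have "(3 / R + 15 / R\<^sup>2 + 3 * d) + 3 / R = 6 / R + 15 / R\<^sup>2 + 3 * d" by simp
  finally show "\<bar>integral (cell R) (\<lambda>x. p x * cutoff_slope R x * radial_moment (partial 3 u) (x + s *\<^sub>R ez))\<bar>
    \<le> (6 / R + 15 / R\<^sup>2 + 3 * d) * D + (45 / R\<^sup>2 + 18 * B / (d * R\<^sup>2)) * integral (cell R) field_sq"
    unfolding q3 by simp
qed

section \<open>Vanishing of the fields\<close>

lemma energy_bound:
  assumes R: "0 < R" and d: "0 < d" and B: "\<And>x. x \<in> cell R \<Longrightarrow> field_sq x \<le> B"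
  shows "integral (cell R) (\<lambda>x. grad_sq x * cutoff R x)
    \<le> 18 / R\<^sup>2 * integral (cell R) field_sq
      + pi * ((6 / R + 15 / R\<^sup>2 + 3 * d) * D + (45 / R\<^sup>2 + 18 * B / (d * R\<^sup>2)) * integral (cell R) field_sq)
      + 2 * (pi * (3 / 2 * d * D + 3 / 2 * B / (d * R\<^sup>2) * integral (cell R) field_sq))"
proof -
  let ?L = "\<lambda>x. field_sq x / 2 * laplacian_cutoff R x"
  let ?P = "\<lambda>x. p x * cutoff_slope R x * radial_moment u x"
  let ?E = "\<lambda>x. field_sq x / 2 * cutoff_slope R x * radial_moment u x"
  let ?S = "\<lambda>x. (u x \<bullet> h x) * cutoff_slope R x * radial_moment h x"
  have Ec: "continuous_on UNIV (\<lambda>x. field_sq x / 2)" unfolding divide_inverse by (intro continuous_intros field_sq_cont)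
  have Sc: "continuous_on UNIV (\<lambda>x. u x \<bullet> h x)" by (intro continuous_intros cont)
  have S_le: "\<bar>u x \<bullet> h x\<bar> \<le> field_sq x / 2" for x
  proof -
    have "\<bar>u x \<bullet> h x\<bar> \<le> norm (u x) * norm (h x)" by (rule Cauchy_Schwarz_ineq2)
    moreover have "2 * (norm (u x) * norm (h x)) \<le> (norm (u x))\<^sup>2 + (norm (h x))\<^sup>2"
      using sum_squares_bound[of "norm (u x)" "norm (h x)"] by simp
    ultimately show ?thesis by (simp add: field_sq_def power2_norm_eq_inner)
  qed
  have i: "?L integrable_on cell R" "?P integrable_on cell R" "?E integrable_on cell R" "?S integrable_on cell R"
    by (intro integrable_cell continuous_on_mult Ec Sc cont continuous_cutoffs)+
  have "integral (cell R) (\<lambda>x. grad_sq x * cutoff R x) = integral (cell R) (\<lambda>x. ?L x + (?E x + ?P x) - ?S x)"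
    unfolding energy_identity[OF R] by (simp add: algebra_simps)
  also have "\<dots> = integral (cell R) ?L + (integral (cell R) ?E + integral (cell R) ?P) - integral (cell R) ?S"
    using i by (simp add: integral_add integral_diff integrable_add)
  also have "\<dots> \<le> \<bar>integral (cell R) ?L\<bar> + \<bar>integral (cell R) ?P\<bar> + (\<bar>integral (cell R) ?E\<bar> + \<bar>integral (cell R) ?S\<bar>)"
    by linarith
  also have "\<dots> \<le> 18 / R\<^sup>2 * integral (cell R) field_sq
      + pi * ((6 / R + 15 / R\<^sup>2 + 3 * d) * D + (45 / R\<^sup>2 + 18 * B / (d * R\<^sup>2)) * integral (cell R) field_sq)
      + (pi * (3 / 2 * d * D + 3 / 2 * B / (d * R\<^sup>2) * integral (cell R) field_sq)
       + pi * (3 / 2 * d * D + 3 / 2 * B / (d * R\<^sup>2) * integral (cell R) field_sq))"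
  proof (intro add_mono)
    have "\<bar>integral (cell R) ?L\<bar> \<le> integral (cell R) (\<lambda>x. 18 / R\<^sup>2 * field_sq x)"
    proof (rule abs_integral_cell_le)
      fix x assume x: "x \<in> cell R"
      have "\<bar>?L x\<bar> \<le> field_sq x / 2 * (36 / R\<^sup>2)"
        unfolding abs_mult using field_sq_nonneg[of x]
        by (intro mult_mono abs_laplacian_cutoff_le[OF R rad_le_cell[OF x]]) auto
      then show "\<bar>?L x\<bar> \<le> 18 / R\<^sup>2 * field_sq x" by simp
    qed (intro continuous_on_mult Ec continuous_cutoffs continuous_on_const field_sq_cont)+
    then show "\<bar>integral (cell R) ?L\<bar> \<le> 18 / R\<^sup>2 * integral (cell R) field_sq" by simp
    show "\<bar>integral (cell R) ?P\<bar> \<le> pi * ((6 / R + 15 / R\<^sup>2 + 3 * d) * D + (45 / R\<^sup>2 + 18 * B / (d * R\<^sup>2)) * integral (cell R) field_sq)"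
      by (rule pressure_bound[OF R d B])
    show "\<bar>integral (cell R) ?E\<bar> \<le> pi * (3 / 2 * d * D + 3 / 2 * B / (d * R\<^sup>2) * integral (cell R) field_sq)"
      by (rule drift_bound[OF R d B smooth_u swirl_u div_u per_u norm_partial_sq_le(1) Ec]) (simp_all add: field_sq_nonneg)
    show "\<bar>integral (cell R) ?S\<bar> \<le> pi * (3 / 2 * d * D + 3 / 2 * B / (d * R\<^sup>2) * integral (cell R) field_sq)"
      by (rule drift_bound[OF R d B smooth_h swirl_h div_h per_h norm_partial_sq_le(2) Sc S_le])
  qed
  finally show ?thesis by simp
qed

text \<open>With \<open>A\<close> the scaled mean square, the choice \<open>d = sqrt A + 1 / R\<close> tends to zero while \<open>A / d \<le> sqrt A\<close> does too;
the summand \<open>1 / R\<close> keeps \<open>d\<close> positive where \<open>A\<close> vanishes.\<close>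

lemma localized_dirichlet_tendsto_0:
  "((\<lambda>R. integral (cell R) (\<lambda>x. grad_sq x * cutoff R x)) \<longlongrightarrow> 0) at_top"
proof -
  obtain B where B1: "1 \<le> B" and B: "\<And>x R. x \<in> cell R \<Longrightarrow> field_sq x \<le> B"
    using bounded_on_cells[OF field_sq_cont field_sq_decay] by blast
  define A where "A R = integral (cell R) field_sq / R\<^sup>2" for R
  define d where "d R = sqrt (A R) + 1 / R" for R
  define M where "M R = 18 * A R + pi * ((6 / R + 15 * (1 / R)\<^sup>2 + 3 * d R) * D + (45 * A R + 18 * B * sqrt (A R)))
      + 2 * (pi * (3 / 2 * d R * D + 3 / 2 * B * sqrt (A R)))" for R
  have A0: "(A \<longlongrightarrow> 0) at_top"
    unfolding A_def by (rule mean_square_tendsto_0[OF field_sq_cont field_sq_nonneg field_sq_decay])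
  have R0: "((\<lambda>R::real. 1 / R) \<longlongrightarrow> 0) at_top"
    by (intro tendsto_divide_0[OF tendsto_const] filterlim_at_top_imp_at_infinity filterlim_ident)
  have sA0: "((\<lambda>R. sqrt (A R)) \<longlongrightarrow> 0) at_top"
    using tendsto_real_sqrt[OF A0] by simp
  have d0: "(d \<longlongrightarrow> 0) at_top"
    unfolding d_def[abs_def] using tendsto_add[OF sA0 R0] by simp
  have M0: "(M \<longlongrightarrow> 0) at_top"
  proof -
    have "((\<lambda>R. 18 * A R + pi * ((6 * (1 / R) + 15 * (1 / R)\<^sup>2 + 3 * d R) * D + (45 * A R + 18 * B * sqrt (A R)))
      + 2 * (pi * (3 / 2 * d R * D + 3 / 2 * B * sqrt (A R)))) \<longlongrightarrow>
       18 * 0 + pi * ((6 * 0 + 15 * 0\<^sup>2 + 3 * 0) * D + (45 * 0 + 18 * B * 0)) + 2 * (pi * (3 / 2 * 0 * D + 3 / 2 * B * 0))) at_top"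
      by (intro tendsto_intros A0 R0 sA0 d0)
    then show ?thesis by (simp add: M_def[abs_def])
  qed
  have "\<forall>\<^sub>F R in at_top. integral (cell R) (\<lambda>x. grad_sq x * cutoff R x) \<le> M R"
    using eventually_gt_at_top[of 0]
  proof eventually_elim
    case (elim R)
    have A_nn: "0 \<le> A R"
      unfolding A_def by (intro divide_nonneg_nonneg integral_nonneg integrable_cell field_sq_cont) (auto simp: field_sq_nonneg)
    then have dpos: "0 < d R" using elim by (simp add: d_def add_nonneg_pos)
    have "A R = sqrt (A R) * sqrt (A R)" using A_nn by simp
    also have "\<dots> \<le> sqrt (A R) * d R"
      using A_nn elim by (intro mult_left_mono) (auto simp: d_def)
    finally have Ad: "A R / d R \<le> sqrt (A R)" using dpos by (simp add: field_simps)
    have "integral (cell R) (\<lambda>x. grad_sq x * cutoff R x) \<le> 18 / R\<^sup>2 * integral (cell R) field_sq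
      + pi * ((6 / R + 15 / R\<^sup>2 + 3 * d R) * D + (45 / R\<^sup>2 + 18 * B / (d R * R\<^sup>2)) * integral (cell R) field_sq)
      + 2 * (pi * (3 / 2 * d R * D + 3 / 2 * B / (d R * R\<^sup>2) * integral (cell R) field_sq))"
      by (rule energy_bound[OF elim dpos B])
    also have "\<dots> = 18 * A R + pi * ((6 / R + 15 * (1 / R)\<^sup>2 + 3 * d R) * D + (45 * A R + 18 * B * (A R / d R)))
      + 2 * (pi * (3 / 2 * d R * D + 3 / 2 * B * (A R / d R)))"
      by (simp add: A_def power_divide distrib_right mult.commute[of "R\<^sup>2"])
    also have "\<dots> \<le> M R"
      unfolding M_def using B1 by (intro add_mono mult_left_mono Ad order_refl) auto
    finally show ?case .
  qed
  moreover have "\<forall>\<^sub>F R in at_top. 0 \<le> integral (cell R) (\<lambda>x. grad_sq x * cutoff R x)"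
    using eventually_gt_at_top[of 0]
    by eventually_elim
       (intro integral_nonneg integrable_cell continuous_on_mult grad_sq_cont continuous_cutoffs, simp add: grad_sq_nonneg cutoff_bounds)
  ultimately show ?thesis
    by (intro tendsto_sandwich[OF _ _ tendsto_const M0])
qed

lemma integral_cell_grad_sq_eq_0: "integral (cell R) grad_sq = 0"
proof -
  have "\<forall>\<^sub>F Q in at_top. integral (cell R) grad_sq \<le> 8 * integral (cell Q) (\<lambda>x. grad_sq x * cutoff Q x)"
    using eventually_ge_at_top[of "max 1 (2 * \<bar>R\<bar>)"]
  proof eventually_elim
    case (elim Q)
    then have Q: "0 < Q" "2 * \<bar>R\<bar> \<le> Q" by auto
    have c: "continuous_on UNIV (\<lambda>x. 8 * (grad_sq x * cutoff Q x))"
      by (intro continuous_intros grad_sq_cont continuous_cutoffs)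
    have "integral (cell R) grad_sq \<le> integral (cell R) (\<lambda>x. 8 * (grad_sq x * cutoff Q x))"
    proof (intro integral_le integrable_cell grad_sq_cont c)
      fix x assume "x \<in> cell R"
      then have "rad x \<le> Q / 2" using rad_le_cell[of x R] Q by linarith
      then have "(rad x)\<^sup>2 \<le> (Q / 2)\<^sup>2" by (intro power_mono rad_nonneg)
      also have "(Q / 2)\<^sup>2 \<le> Q\<^sup>2 / 2" by (simp add: power_divide)
      finally have "(rad x)\<^sup>2 \<le> Q\<^sup>2 / 2" .
      from cutoff_ge_eighth[OF Q(1) this] have "grad_sq x * 1 \<le> grad_sq x * (8 * cutoff Q x)"
        by (intro mult_left_mono grad_sq_nonneg) simp
      then show "grad_sq x \<le> 8 * (grad_sq x * cutoff Q x)" by simp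
    qed
    also have "\<dots> \<le> integral (cell Q) (\<lambda>x. 8 * (grad_sq x * cutoff Q x))"
      using Q by (intro integral_subset_le integrable_cell c) (auto simp: cell_def slab_def grad_sq_nonneg cutoff_bounds)
    finally show ?case by simp
  qed
  moreover have "((\<lambda>Q. 8 * integral (cell Q) (\<lambda>x. grad_sq x * cutoff Q x)) \<longlongrightarrow> 8 * 0) at_top"
    by (intro tendsto_intros localized_dirichlet_tendsto_0)
  ultimately have "integral (cell R) grad_sq \<le> 8 * 0"
    by (intro tendsto_lowerbound) auto
  moreover have "0 \<le> integral (cell R) grad_sq"
    by (intro integral_nonneg integrable_cell grad_sq_cont) (auto simp: grad_sq_nonneg)
  ultimately show ?thesis by simp
qed

text \<open>A continuous nonnegative function with vanishing integral is zero; the boxes exhaust the strip below its open upper face, and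
periodicity covers the rest.\<close>

lemma grad_sq_eq_0: "grad_sq x = 0"
proof -
  have strip: "grad_sq y = 0" if y: "- pi \<le> y $ 3" "y $ 3 < pi" for y
  proof -
    define m where "m = rad y + 1"
    \<comment> \<open>The box must contain \<open>y\<close>, have nonempty interior, and stay below the open upper face of the strip.\<close>
    define c where "c = max (y $ 3) 0"
    let ?a = "vector [-m, -m, -pi] :: real^3" and ?b = "vector [m, m, c] :: real^3"
    have m: "0 < m" using rad_nonneg[of y] by (simp add: m_def)
    have c: "- pi < c" "c < pi" "y $ 3 \<le> c" using y pi_gt_zero by (auto simp: c_def)
    have sub: "cbox ?a ?b \<subseteq> cell (2 * m)"
    proof
      fix x assume x: "x \<in> cbox ?a ?b"
      then have *: "- m \<le> x $ 1 \<and> x $ 1 \<le> m \<and> - m \<le> x $ 2 \<and> x $ 2 \<le> m \<and> - pi \<le> x $ 3 \<and> x $ 3 \<le> c"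
        unfolding mem_box_cart forall_3 vector_3 by blast
      have "rad x \<le> \<bar>x $ 1\<bar> + \<bar>x $ 2\<bar>" unfolding rad_def by (rule sqrt_sum_squares_le_sum_abs)
      then show "x \<in> cell (2 * m)" using * c unfolding cell_def slab_def by auto
    qed
    have int: "grad_sq integrable_on cbox ?a ?b"
      by (intro integrable_continuous continuous_on_subset[OF grad_sq_cont]) auto
    have "integral (cbox ?a ?b) grad_sq \<le> integral (cell (2 * m)) grad_sq"
      by (intro integral_subset_le sub int integrable_cell grad_sq_cont) (auto simp: grad_sq_nonneg)
    moreover have "0 \<le> integral (cbox ?a ?b) grad_sq"
      by (intro integral_nonneg int) (auto simp: grad_sq_nonneg)
    ultimately have "integral (cbox ?a ?b) grad_sq = 0"
      by (simp add: integral_cell_grad_sq_eq_0)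
    then have 0: "(grad_sq has_integral 0) (cbox ?a ?b)"
      using int by (metis integrable_integral)
    show "grad_sq y = 0"
    proof (rule has_integral_0_cbox_imp_0[OF continuous_on_subset[OF grad_sq_cont subset_UNIV] _ 0])
      show "0 \<le> grad_sq x" for x by (rule grad_sq_nonneg)
      show "box ?a ?b \<noteq> {}" using m c by (auto simp: interval_ne_empty_cart forall_3)
      show "y \<in> cbox ?a ?b"
        using abs_component_le_rad[of y] y c by (auto simp: mem_box_cart forall_3 m_def)
    qed
  qed
  obtain k :: int where "- pi \<le> (x + (2 * pi * of_int k) *\<^sub>R ez) $ 3" "(x + (2 * pi * of_int k) *\<^sub>R ez) $ 3 < pi"
    by (rule periodic_point_in_strip)
  from strip[OF this] show ?thesis by (simp add: z_periodic_int[OF grad_sq_per])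
qed

lemma fields_vanish: "u x = 0" "h x = 0"
proof -
  have g: "partial i u x = 0" "partial i h x = 0" for i x
    using norm_partial_sq_le[of i x] by (simp_all add: grad_sq_eq_0)
  have small: "\<exists>x. norm (u x) \<le> e \<and> norm (h x) \<le> e" if e: "0 < e" for e
  proof -
    obtain R0 where R0: "\<And>x. R0 \<le> rad x \<Longrightarrow> field_sq x \<le> e\<^sup>2"
      using field_sq_decay[of "e\<^sup>2"] e by auto
    have "R0 \<le> rad (vector [R0, 0, 0])" by (simp add: rad_def)
    from R0[OF this] have "field_sq (vector [R0, 0, 0]) \<le> e\<^sup>2" .
    then have "(norm (u (vector [R0, 0, 0])))\<^sup>2 \<le> e\<^sup>2" "(norm (h (vector [R0, 0, 0])))\<^sup>2 \<le> e\<^sup>2"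
      using norm_u_sq_le norm_h_sq_le order_trans by blast+
    then show ?thesis using e by (meson less_imp_le power2_le_imp_le)
  qed
  show "u x = 0" by (rule eq_0_if_gradient_eq_0[OF smooth_u g(1)]) (use small in blast)
  show "h x = 0" by (rule eq_0_if_gradient_eq_0[OF smooth_h g(2)]) (use small in blast)
qed

end

lemma grad_norm_sq_eq: "grad_norm_sq v x = (\<Sum>i\<in>UNIV. partial i v x \<bullet> partial i v x)"
  by (simp add: grad_norm_sq_def inner_vec_def power2_eq_square)

lemma norm_tendsto_0_horizontal_infinityD:
  assumes "((\<lambda>x. norm (v x)) \<longlongrightarrow> 0) horizontal_infinity" "0 < e"
  obtains R0 where "\<And>x. R0 \<le> rad x \<Longrightarrow> norm (v x) < e"
proof -
  have "\<forall>\<^sub>F x in horizontal_infinity. norm (v x) < e"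
    using order_tendstoD(2)[OF assms] .
  then obtain R0 where "\<forall>x. R0 \<le> rad x \<longrightarrow> norm (v x) < e"
    unfolding horizontal_infinity_def eventually_filtercomap_at_top_linorder ..
  then show thesis using that by blast
qed

theorem theorem1p1:
  fixes u h :: "real^3 \<Rightarrow> real^3" and p :: "real^3 \<Rightarrow> real"
  assumes smooth_u: "smooth u" and smooth_h: "smooth h" and smooth_p: "smooth p"
    and momentum: "\<And>x. advect u u x + gradient p x - advect h h x - laplacian u x = 0"
    and induction_eq: "\<And>x. advect u h x - advect h u x - laplacian h x = 0"
    and div_u: "\<And>x. divergence u x = 0" and div_h: "\<And>x. divergence h x = 0"
    and per_u: "z_periodic u" and per_h: "z_periodic h"
    and lim_u: "((\<lambda>x. norm (u x)) \<longlongrightarrow> 0) horizontal_infinity"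
    and lim_h: "((\<lambda>x. norm (h x)) \<longlongrightarrow> 0) horizontal_infinity"
    and dirichlet: "(\<integral>\<^sup>+x\<in>period_cell. ennreal (grad_norm_sq u x) \<partial>lborel)
        + (\<integral>\<^sup>+x\<in>period_cell. ennreal (grad_norm_sq h x) \<partial>lborel) < \<infinity>"
    and swirl_u: "\<And>x. rad x > 0 \<Longrightarrow> swirl_comp u x = 0"
    and swirl_h: "\<And>x. rad x > 0 \<Longrightarrow> swirl_comp h x = 0"
  shows "(\<forall>x. u x = 0) \<and> (\<forall>x. h x = 0)"
proof -
  define Du where "Du = enn2real (\<integral>\<^sup>+x\<in>period_cell. ennreal (grad_norm_sq u x) \<partial>lborel)"
  define Dh where "Dh = enn2real (\<integral>\<^sup>+x\<in>period_cell. ennreal (grad_norm_sq h x) \<partial>lborel)"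
  have gc: "continuous_on UNIV (grad_norm_sq v)" if "smooth v" for v
    unfolding grad_norm_sq_eq by (intro continuous_intros smooth_continuous smooth_partial that)
  have gn: "0 \<le> grad_norm_sq v x" for v x
    unfolding grad_norm_sq_eq by (intro sum_nonneg) simp
  have fin: "(\<integral>\<^sup>+x\<in>period_cell. ennreal (grad_norm_sq u x) \<partial>lborel) < \<infinity>"
    "(\<integral>\<^sup>+x\<in>period_cell. ennreal (grad_norm_sq h x) \<partial>lborel) < \<infinity>"
    using dirichlet by (auto simp: less_top[symmetric])
  interpret swirl_free_mhd u h p "Du + Dh"
  proof
    show "swirl_free u" by (rule swirl_free_if_swirl_comp_0[OF swirl_u])
    show "swirl_free h" by (rule swirl_free_if_swirl_comp_0[OF swirl_h])
    fix e :: real assume e: "0 < e"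
    obtain R1 where R1: "\<And>x. R1 \<le> rad x \<Longrightarrow> norm (u x) < sqrt (e / 2)"
      using norm_tendsto_0_horizontal_infinityD[OF lim_u, of "sqrt (e / 2)"] e by auto
    obtain R2 where R2: "\<And>x. R2 \<le> rad x \<Longrightarrow> norm (h x) < sqrt (e / 2)"
      using norm_tendsto_0_horizontal_infinityD[OF lim_h, of "sqrt (e / 2)"] e by auto
    have sq: "w \<bullet> w \<le> e / 2" if "norm w < sqrt (e / 2)" for w :: "real^3"
      using power_mono[of "norm w" "sqrt (e / 2)" 2] that e by (simp add: power2_norm_eq_inner)
    have "u x \<bullet> u x + h x \<bullet> h x \<le> e" if "max R1 R2 \<le> rad x" for x
      using sq[OF R1[of x]] sq[OF R2[of x]] that by simp
    then show "\<exists>R0. \<forall>x. R0 \<le> rad x \<longrightarrow> u x \<bullet> u x + h x \<bullet> h x \<le> e" by blast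
  next
    fix R
    have "integral (cell R) (\<lambda>x. \<Sum>i\<in>UNIV. partial i u x \<bullet> partial i u x + partial i h x \<bullet> partial i h x)
      = integral (cell R) (\<lambda>x. grad_norm_sq u x + grad_norm_sq h x)"
      by (simp add: grad_norm_sq_eq sum.distrib)
    also have "\<dots> = integral (cell R) (grad_norm_sq u) + integral (cell R) (grad_norm_sq h)"
      by (intro integral_add integrable_cell gc smooth_u smooth_h)
    also have "\<dots> \<le> Du + Dh"
      unfolding Du_def Dh_def
      by (intro add_mono integral_cell_le_nn_integral gc gn smooth_u smooth_h fin)
    finally show "integral (cell R) (\<lambda>x. \<Sum>i\<in>UNIV. partial i u x \<bullet> partial i u x + partial i h x \<bullet> partial i h x) \<le> Du + Dh" .
  qed (use assms in auto)
  show ?thesis using fields_vanish by blast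
qed

end
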